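(* Let $\mathcal{D}$ be an extriangulated category with negative first extension and let $[\mathbf{t}_1,\mathbf{t}_2]$ be a normal interval in $\mathsf{stors}\,\mathcal{D}$ such that every morphism $f:X\to Y$ in $\mathcal{H}_{[\mathbf{t}_1,\mathbf{t}_2]}$ admits $\mathfrak{s}$-conflations in $\mathcal{D}$ of the form $$X\xrightarrow{f}Y\xrightarrow{c}Z\quad\text{and}\quad K\xrightarrow{k}X\xrightarrow{f}Y.$$ Then $\mathcal{H}_{[\mathbf{t}_1,\mathbf{t}_2]}$ is an exact and a semi-abelian category.
   Context: Extriangulated categories $(\mathcal{D},\mathbb{E},\mathfrak{s})$ are in the sense of Nakaoka–Palu; an $\mathfrak{s}$-conflation (= $\mathbb{E}$-triangle) is a sequence $A\to B\to C$ realizing an element of $\mathbb{E}(C,A)$. $\mathcal{D}$ has negative first extension if there are an additive bifunctor $\mathbb{E}^{-1}:\mathcal{D}^{op}\times\mathcal{D}\to\mathrm{Ab}$ and, for each $\delta\in\mathbb{E}(C,A)$, natural transformations $\delta^{-1}:\mathbb{E}^{-1}(-,C)\to\mathcal{D}(-,A)$ and $\delta_{-1}:\mathbb{E}^{-1}(A,-)\to\mathcal{D}(C,-)$ such that, for each $\mathfrak{s}$-conflation $A\to B\to C$ realizing $\delta$ and each $W\in\mathcal{D}$, the sequences $\mathbb{E}^{-1}(W,A)\to\mathbb{E}^{-1}(W,B)\to\mathbb{E}^{-1}(W,C)\xrightarrow{\delta^{-1}}\mathcal{D}(W,A)\to\mathcal{D}(W,B)$ and $\mathbb{E}^{-1}(C,W)\to\mathbb{E}^{-1}(B,W)\to\mathbb{E}^{-1}(A,W)\xrightarrow{\delta_{-1}}\mathcal{D}(C,W)\to\mathcal{D}(B,W)$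 are exact. A full extension-closed subcategory of $\mathcal{D}$ inherits by restriction the structure of an extriangulated category with negative first extension. An $s$-torsion pair in $\mathcal{D}$ is a pair $(\mathcal{T},\mathcal{F})$ of full isomorphism-closed subcategories with $\mathcal{D}(\mathcal{T},\mathcal{F})=0$, $\mathbb{E}^{-1}(\mathcal{T},\mathcal{F})=0$, and such that every $D\in\mathcal{D}$ admits an $\mathfrak{s}$-conflation $T\to D\to F$ with $T\in\mathcal{T}$, $F\in\mathcal{F}$. $\mathsf{stors}\,\mathcal{D}$ is the poset of $s$-torsion pairs, with $(\mathcal{T},\mathcal{F})\le(\mathcal{T}',\mathcal{F}')$ iff $\mathcal{T}\subseteq\mathcal{T}'$. For $\mathbf{t}_1=(\mathcal{T}_1,\mathcal{F}_1)\le\mathbf{t}_2=(\mathcal{T}_2,\mathcal{F}_2)$, the interval is $[\mathbf{t}_1,\mathbf{t}_2]=\{\mathbf{t}:\mathbf{t}_1\le\mathbf{t}\le\mathbf{t}_2\}$, and its heart is the extension-closed subcategory $\mathcal{H}_{[\mathbf{t}_1,\mathbf{t}_2]}=\mathcal{F}_1\cap\mathcal{T}_2$. The interval is normal if $\mathbb{E}^{-1}(\mathcal{T}_2,\mathcal{F}_1)=0$. "$\mathcal{H}_{[\mathbf{t}_1,\mathbf{t}_2]}$ is exact" means that, with its $\mathfrak{s}$-conflations (those of $\mathcal{D}$ with all three terms in the heart), it is an exact category in the sense of Quillen. An additive category is semi-abelian if it has kernels and cokernels and, for each morphism $f$, the canonical morphism $\mathrm{CoIm}(f)=\mathrm{Coker}(\mathrm{Ker}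 f)\to\mathrm{Im}(f)=\mathrm{Ker}(\mathrm{Coker} f)$ is both a monomorphism and an epimorphism. *)

theory Defs
  imports "HOL-Algebra.Coset"
begin

text \<open>
  Throughout, abelian groups are HOL-Algebra's \<open>comm_group\<close>s, so they are written multiplicatively:
  \<open>f \<otimes>\<^bsub>Hom C A B\<^esub> g\<close> is the sum and \<open>\<one>\<^bsub>Hom C A B\<^esub>\<close> the zero morphism.

  Hom-sets (and extension groups) are indexed by their objects and need not be disjoint, so the
  predicates below take the objects concerned as explicit arguments.
\<close>

section \<open>Additive categories\<close>

record ('o, 'm) cat =
  Obj :: "'o set"
  Hom :: "'o \<Rightarrow> 'o \<Rightarrow> 'm monoid"
  ide :: "'o \<Rightarrow> 'm"
  comp :: "'m \<Rightarrow> 'm \<Rightarrow> 'm"  (infixr \<open>\<cdot>\<index>\<close> 75)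

abbreviation mor :: "('o, 'm, 'z) cat_scheme \<Rightarrow> 'o \<Rightarrow> 'o \<Rightarrow> 'm set"
  where "mor C A B \<equiv> carrier (Hom C A B)"

abbreviation zero_mor :: "('o, 'm, 'z) cat_scheme \<Rightarrow> 'o \<Rightarrow> 'o \<Rightarrow> 'm"
  where "zero_mor C A B \<equiv> \<one>\<^bsub>Hom C A B\<^esub>"

locale preadditive_category =
  fixes C :: "('o, 'm, 'z) cat_scheme" (structure)
  assumes hom_comm_group: "\<lbrakk>X \<in> Obj C; Y \<in> Obj C\<rbrakk> \<Longrightarrow> comm_group (Hom C X Y)"
    and ide_in: "X \<in> Obj C \<Longrightarrow> ide C X \<in> mor C X X"
    and comp_in: "\<lbrakk>X \<in> Obj C; Y \<in> Obj C; Z \<in> Obj C; f \<in> mor C X Y; g \<in> mor C Y Z\<rbrakk>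
      \<Longrightarrow> g \<cdot> f \<in> mor C X Z"
    and comp_ide_right: "\<lbrakk>X \<in> Obj C; Y \<in> Obj C; f \<in> mor C X Y\<rbrakk> \<Longrightarrow> f \<cdot> ide C X = f"
    and comp_ide_left: "\<lbrakk>X \<in> Obj C; Y \<in> Obj C; f \<in> mor C X Y\<rbrakk> \<Longrightarrow> ide C Y \<cdot> f = f"
    and comp_assoc: "\<lbrakk>W \<in> Obj C; X \<in> Obj C; Y \<in> Obj C; Z \<in> Obj C;
        f \<in> mor C W X; g \<in> mor C X Y; h \<in> mor C Y Z\<rbrakk>
      \<Longrightarrow> (h \<cdot> g) \<cdot> f = h \<cdot> (g \<cdot> f)"
    and comp_add_right: "\<lbrakk>X \<in> Obj C; Y \<in> Obj C; Z \<in> Obj C;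
        f \<in> mor C X Y; f' \<in> mor C X Y; g \<in> mor C Y Z\<rbrakk>
      \<Longrightarrow> g \<cdot> (f \<otimes>\<^bsub>Hom C X Y\<^esub> f') = (g \<cdot> f) \<otimes>\<^bsub>Hom C X Z\<^esub> (g \<cdot> f')"
    and comp_add_left: "\<lbrakk>X \<in> Obj C; Y \<in> Obj C; Z \<in> Obj C;
        f \<in> mor C X Y; g \<in> mor C Y Z; g' \<in> mor C Y Z\<rbrakk>
      \<Longrightarrow> (g \<otimes>\<^bsub>Hom C Y Z\<^esub> g') \<cdot> f = (g \<cdot> f) \<otimes>\<^bsub>Hom C X Z\<^esub> (g' \<cdot> f)"

definition zero_object :: "('o, 'm, 'z) cat_scheme \<Rightarrow> 'o \<Rightarrow> bool"
  where "zero_object C Z \<longleftrightarrow> Z \<in> Obj C \<and>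
    (\<forall>X\<in>Obj C. (\<exists>!f. f \<in> mor C X Z) \<and> (\<exists>!f. f \<in> mor C Z X))"

definition biproduct ::
    "('o, 'm, 'z) cat_scheme \<Rightarrow> 'o \<Rightarrow> 'o \<Rightarrow> 'o \<Rightarrow> 'm \<Rightarrow> 'm \<Rightarrow> 'm \<Rightarrow> 'm \<Rightarrow> bool"
  where "biproduct C A B S i j p q \<longleftrightarrow>
    S \<in> Obj C \<and> i \<in> mor C A S \<and> j \<in> mor C B S \<and> p \<in> mor C S A \<and> q \<in> mor C S B \<and>
    p \<cdot>\<^bsub>C\<^esub> i = ide C A \<and> q \<cdot>\<^bsub>C\<^esub> j = ide C B \<and>
    q \<cdot>\<^bsub>C\<^esub> i = zero_mor C A B \<and> p \<cdot>\<^bsub>C\<^esub> j = zero_mor C B A \<and>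
    (i \<cdot>\<^bsub>C\<^esub> p) \<otimes>\<^bsub>Hom C S S\<^esub> (j \<cdot>\<^bsub>C\<^esub> q) = ide C S"

locale additive_category = preadditive_category +
  assumes has_zero_object: "\<exists>Z. zero_object C Z"
    and has_biproducts: "\<lbrakk>A \<in> Obj C; B \<in> Obj C\<rbrakk> \<Longrightarrow> \<exists>S i j p q. biproduct C A B S i j p q"

definition isomorphism :: "('o, 'm, 'z) cat_scheme \<Rightarrow> 'o \<Rightarrow> 'o \<Rightarrow> 'm \<Rightarrow> bool"
  where "isomorphism C A B f \<longleftrightarrow> f \<in> mor C A B \<and>
    (\<exists>g\<in>mor C B A. g \<cdot>\<^bsub>C\<^esub> f = ide C A \<and> f \<cdot>\<^bsub>C\<^esub> g = ide C B)"

definition monomorphism :: "('o, 'm, 'z) cat_scheme \<Rightarrow> 'o \<Rightarrow> 'o \<Rightarrow> 'm \<Rightarrow> bool"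
  where "monomorphism C A B f \<longleftrightarrow> f \<in> mor C A B \<and>
    (\<forall>W\<in>Obj C. \<forall>g\<in>mor C W A. \<forall>h\<in>mor C W A. f \<cdot>\<^bsub>C\<^esub> g = f \<cdot>\<^bsub>C\<^esub> h \<longrightarrow> g = h)"

definition epimorphism :: "('o, 'm, 'z) cat_scheme \<Rightarrow> 'o \<Rightarrow> 'o \<Rightarrow> 'm \<Rightarrow> bool"
  where "epimorphism C A B f \<longleftrightarrow> f \<in> mor C A B \<and>
    (\<forall>W\<in>Obj C. \<forall>g\<in>mor C B W. \<forall>h\<in>mor C B W. g \<cdot>\<^bsub>C\<^esub> f = h \<cdot>\<^bsub>C\<^esub> f \<longrightarrow> g = h)"

definition is_kernel :: "('o, 'm, 'z) cat_scheme \<Rightarrow> 'o \<Rightarrow> 'o \<Rightarrow> 'm \<Rightarrow> 'o \<Rightarrow> 'm \<Rightarrow> bool"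
  where "is_kernel C X Y f K k \<longleftrightarrow>
    K \<in> Obj C \<and> k \<in> mor C K X \<and> f \<cdot>\<^bsub>C\<^esub> k = zero_mor C K Y \<and>
    (\<forall>W\<in>Obj C. \<forall>g\<in>mor C W X. f \<cdot>\<^bsub>C\<^esub> g = zero_mor C W Y \<longrightarrow>
      (\<exists>!h. h \<in> mor C W K \<and> k \<cdot>\<^bsub>C\<^esub> h = g))"

definition is_cokernel :: "('o, 'm, 'z) cat_scheme \<Rightarrow> 'o \<Rightarrow> 'o \<Rightarrow> 'm \<Rightarrow> 'o \<Rightarrow> 'm \<Rightarrow> bool"
  where "is_cokernel C X Y f Q q \<longleftrightarrow>
    Q \<in> Obj C \<and> q \<in> mor C Y Q \<and> q \<cdot>\<^bsub>C\<^esub> f = zero_mor C X Q \<and>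
    (\<forall>W\<in>Obj C. \<forall>g\<in>mor C Y W. g \<cdot>\<^bsub>C\<^esub> f = zero_mor C X W \<longrightarrow>
      (\<exists>!h. h \<in> mor C Q W \<and> h \<cdot>\<^bsub>C\<^esub> q = g))"

definition full_subcategory :: "('o, 'm, 'z) cat_scheme \<Rightarrow> 'o set \<Rightarrow> ('o, 'm, 'z) cat_scheme"
  where "full_subcategory C S = C\<lparr>Obj := S\<rparr>"


section \<open>Semi-abelian categories\<close>

text \<open>
  In \<open>coimage_image\<close>, \<open>(Q, q)\<close> is the coimage \<open>Coker (Ker f)\<close> and \<open>(I, m)\<close> the image
  \<open>Ker (Coker f)\<close>. The canonical morphism is the \<open>u\<close> with \<open>m \<cdot> u \<cdot> q = f\<close>; it is unique since
  \<open>q\<close> is an epimorphism and \<open>m\<close> a monomorphism.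
\<close>

locale semi_abelian_category = additive_category +
  assumes has_kernels: "\<lbrakk>X \<in> Obj C; Y \<in> Obj C; f \<in> mor C X Y\<rbrakk> \<Longrightarrow> \<exists>K k. is_kernel C X Y f K k"
    and has_cokernels: "\<lbrakk>X \<in> Obj C; Y \<in> Obj C; f \<in> mor C X Y\<rbrakk> \<Longrightarrow> \<exists>Z c. is_cokernel C X Y f Z c"
    and coimage_image: "\<lbrakk>X \<in> Obj C; Y \<in> Obj C; f \<in> mor C X Y;
        is_kernel C X Y f K k; is_cokernel C K X k Q q;
        is_cokernel C X Y f Z c; is_kernel C Y Z c I m\<rbrakk>
      \<Longrightarrow> \<exists>u\<in>mor C Q I. m \<cdot> u \<cdot> q = f \<and> monomorphism C Q I u \<and> epimorphism C Q I u"


section \<open>Exact categories in the sense of Quillen\<close>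

text \<open>
  The square with sides \<open>i : A \<rightarrow> B\<close>, \<open>f : A \<rightarrow> A'\<close>, \<open>i' : A' \<rightarrow> P\<close>, \<open>f' : B \<rightarrow> P\<close> is a pushout,
  respectively the one with \<open>p : B \<rightarrow> A\<close>, \<open>f : A' \<rightarrow> A\<close>, \<open>p' : P \<rightarrow> A'\<close>, \<open>f' : P \<rightarrow> B\<close> a pullback.
\<close>

definition is_pushout ::
    "('o, 'm, 'z) cat_scheme \<Rightarrow> 'o \<Rightarrow> 'o \<Rightarrow> 'o \<Rightarrow> 'm \<Rightarrow> 'm \<Rightarrow> 'o \<Rightarrow> 'm \<Rightarrow> 'm \<Rightarrow> bool"
  where "is_pushout C A B A' i f P i' f' \<longleftrightarrow>
    P \<in> Obj C \<and> i' \<in> mor C A' P \<and> f' \<in> mor C B P \<and> f' \<cdot>\<^bsub>C\<^esub> i = i' \<cdot>\<^bsub>C\<^esub> f \<and>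
    (\<forall>W\<in>Obj C. \<forall>g\<in>mor C A' W. \<forall>h\<in>mor C B W. h \<cdot>\<^bsub>C\<^esub> i = g \<cdot>\<^bsub>C\<^esub> f \<longrightarrow>
      (\<exists>!u. u \<in> mor C P W \<and> u \<cdot>\<^bsub>C\<^esub> i' = g \<and> u \<cdot>\<^bsub>C\<^esub> f' = h))"

definition is_pullback ::
    "('o, 'm, 'z) cat_scheme \<Rightarrow> 'o \<Rightarrow> 'o \<Rightarrow> 'o \<Rightarrow> 'm \<Rightarrow> 'm \<Rightarrow> 'o \<Rightarrow> 'm \<Rightarrow> 'm \<Rightarrow> bool"
  where "is_pullback C A B A' p f P p' f' \<longleftrightarrow>
    P \<in> Obj C \<and> p' \<in> mor C P A' \<and> f' \<in> mor C P B \<and> p \<cdot>\<^bsub>C\<^esub> f' = f \<cdot>\<^bsub>C\<^esub> p' \<and>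
    (\<forall>W\<in>Obj C. \<forall>g\<in>mor C W A'. \<forall>h\<in>mor C W B. p \<cdot>\<^bsub>C\<^esub> h = f \<cdot>\<^bsub>C\<^esub> g \<longrightarrow>
      (\<exists>!u. u \<in> mor C W P \<and> p' \<cdot>\<^bsub>C\<^esub> u = g \<and> f' \<cdot>\<^bsub>C\<^esub> u = h))"

text \<open>A tuple \<open>(A, B, Z, i, p)\<close> stands for the sequence \<open>A \<rightarrow> B \<rightarrow> Z\<close> with morphisms \<open>i\<close> and \<open>p\<close>.\<close>

type_synonym ('o, 'm) short_seq = "'o \<times> 'o \<times> 'o \<times> 'm \<times> 'm"

definition inflation :: "('o, 'm) short_seq set \<Rightarrow> 'o \<Rightarrow> 'o \<Rightarrow> 'm \<Rightarrow> bool"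
  where "inflation S A B i \<longleftrightarrow> (\<exists>Z p. (A, B, Z, i, p) \<in> S)"

definition deflation :: "('o, 'm) short_seq set \<Rightarrow> 'o \<Rightarrow> 'o \<Rightarrow> 'm \<Rightarrow> bool"
  where "deflation S B Z p \<longleftrightarrow> (\<exists>A i. (A, B, Z, i, p) \<in> S)"

text \<open>
  Quillen's axioms in the form given by Keller and Buehler, that is, without Quillen's
  ``obscure axiom'', which Keller proved to be a consequence of the others.
\<close>

locale exact_category = additive_category C
  for C :: "('o, 'm, 'z) cat_scheme" (structure)
    and S :: "('o, 'm) short_seq set" +
  assumes kernel_cokernel_pair: "(A, B, Z, i, p) \<in> S \<Longrightarrow>
      A \<in> Obj C \<and> B \<in> Obj C \<and> Z \<in> Obj C \<and> i \<in> mor C A B \<and> p \<in> mor C B Z \<and>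
      is_kernel C B Z p A i \<and> is_cokernel C A B i Z p"
    and iso_closed: "\<lbrakk>(A, B, Z, i, p) \<in> S; A' \<in> Obj C; B' \<in> Obj C; Z' \<in> Obj C;
        i' \<in> mor C A' B'; p' \<in> mor C B' Z';
        isomorphism C A A' a; isomorphism C B B' b; isomorphism C Z Z' z;
        b \<cdot> i = i' \<cdot> a; z \<cdot> p = p' \<cdot> b\<rbrakk>
      \<Longrightarrow> (A', B', Z', i', p') \<in> S"
    and inflation_ide: "A \<in> Obj C \<Longrightarrow> inflation S A A (ide C A)"
    and deflation_ide: "A \<in> Obj C \<Longrightarrow> deflation S A A (ide C A)"
    and inflation_comp: "\<lbrakk>inflation S X Y f; inflation S Y Z g\<rbrakk> \<Longrightarrow> inflation S X Z (g \<cdot> f)"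
    and deflation_comp: "\<lbrakk>deflation S X Y f; deflation S Y Z g\<rbrakk> \<Longrightarrow> deflation S X Z (g \<cdot> f)"
    and inflation_pushout: "\<lbrakk>inflation S A B i; A' \<in> Obj C; f \<in> mor C A A'\<rbrakk>
      \<Longrightarrow> \<exists>P i' f'. is_pushout C A B A' i f P i' f' \<and> inflation S A' P i'"
    and deflation_pullback: "\<lbrakk>deflation S B A p; A' \<in> Obj C; f \<in> mor C A' A\<rbrakk>
      \<Longrightarrow> \<exists>P p' f'. is_pullback C A B A' p f P p' f' \<and> deflation S P A' p'"


section \<open>Additive bifunctors to abelian groups\<close>

text \<open>
  The first argument of \<open>F\<close> is the contravariant one. For \<open>c : C' \<rightarrow> C\<close> and \<open>a : A \<rightarrow> A'\<close>,
  \<open>pb c\<close> is \<open>c\<^sup>* : F C A \<rightarrow> F C' A\<close> and \<open>pf a\<close> is \<open>a\<^sub>* : F C A \<rightarrow> F C A'\<close>.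
\<close>

locale additive_bifunctor = preadditive_category C
  for C :: "('o, 'm, 'z) cat_scheme" (structure)
    and F :: "'o \<Rightarrow> 'o \<Rightarrow> 'e monoid"
    and pb :: "'m \<Rightarrow> 'e \<Rightarrow> 'e"
    and pf :: "'m \<Rightarrow> 'e \<Rightarrow> 'e" +
  assumes val_comm_group: "\<lbrakk>X \<in> Obj C; A \<in> Obj C\<rbrakk> \<Longrightarrow> comm_group (F X A)"
    and pb_hom: "\<lbrakk>X \<in> Obj C; Y \<in> Obj C; A \<in> Obj C; c \<in> mor C Y X\<rbrakk>
      \<Longrightarrow> pb c \<in> hom (F X A) (F Y A)"
    and pf_hom: "\<lbrakk>X \<in> Obj C; A \<in> Obj C; B \<in> Obj C; a \<in> mor C A B\<rbrakk>
      \<Longrightarrow> pf a \<in> hom (F X A) (F X B)"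
    and pb_ide: "\<lbrakk>X \<in> Obj C; A \<in> Obj C; e \<in> carrier (F X A)\<rbrakk> \<Longrightarrow> pb (ide C X) e = e"
    and pf_ide: "\<lbrakk>X \<in> Obj C; A \<in> Obj C; e \<in> carrier (F X A)\<rbrakk> \<Longrightarrow> pf (ide C A) e = e"
    and pb_comp: "\<lbrakk>X \<in> Obj C; Y \<in> Obj C; Z \<in> Obj C; A \<in> Obj C;
        c \<in> mor C Y X; d \<in> mor C Z Y; e \<in> carrier (F X A)\<rbrakk>
      \<Longrightarrow> pb (c \<cdot> d) e = pb d (pb c e)"
    and pf_comp: "\<lbrakk>X \<in> Obj C; A \<in> Obj C; B \<in> Obj C; D \<in> Obj C;
        a \<in> mor C A B; b \<in> mor C B D; e \<in> carrier (F X A)\<rbrakk>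
      \<Longrightarrow> pf (b \<cdot> a) e = pf b (pf a e)"
    and pb_pf: "\<lbrakk>X \<in> Obj C; Y \<in> Obj C; A \<in> Obj C; B \<in> Obj C;
        c \<in> mor C Y X; a \<in> mor C A B; e \<in> carrier (F X A)\<rbrakk>
      \<Longrightarrow> pb c (pf a e) = pf a (pb c e)"
    and pb_add: "\<lbrakk>X \<in> Obj C; Y \<in> Obj C; A \<in> Obj C;
        c \<in> mor C Y X; d \<in> mor C Y X; e \<in> carrier (F X A)\<rbrakk>
      \<Longrightarrow> pb (c \<otimes>\<^bsub>Hom C Y X\<^esub> d) e = pb c e \<otimes>\<^bsub>F Y A\<^esub> pb d e"
    and pf_add: "\<lbrakk>X \<in> Obj C; A \<in> Obj C; B \<in> Obj C;
        a \<in> mor C A B; b \<in> mor C A B; e \<in> carrier (F X A)\<rbrakk>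
      \<Longrightarrow> pf (a \<otimes>\<^bsub>Hom C A B\<^esub> b) e = pf a e \<otimes>\<^bsub>F X B\<^esub> pf b e"


section \<open>Extriangulated categories\<close>

text \<open>
  \<open>Ext D X A\<close> is \<open>\<EE>(X, A)\<close>, and \<open>realiz D X A \<delta>\<close> is the equivalence class \<open>\<ss>(\<delta>)\<close> of sequences
  \<open>A \<rightarrow> B \<rightarrow> X\<close>, whose members are the triples of the middle term and the two morphisms.
\<close>

record ('o, 'm, 'e) extri = "('o, 'm) cat" +
  Ext :: "'o \<Rightarrow> 'o \<Rightarrow> 'e monoid"
  pull :: "'m \<Rightarrow> 'e \<Rightarrow> 'e"
  push :: "'m \<Rightarrow> 'e \<Rightarrow> 'e"
  realiz :: "'o \<Rightarrow> 'o \<Rightarrow> 'e \<Rightarrow> ('o \<times> 'm \<times> 'm) set"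

definition seqs :: "('o, 'm, 'z) cat_scheme \<Rightarrow> 'o \<Rightarrow> 'o \<Rightarrow> ('o \<times> 'm \<times> 'm) set"
  where "seqs C A X = {(B, x, y). B \<in> Obj C \<and> x \<in> mor C A B \<and> y \<in> mor C B X}"

definition seq_equiv :: "('o, 'm, 'z) cat_scheme \<Rightarrow> 'o \<Rightarrow> 'o \<Rightarrow> ('o \<times> 'm \<times> 'm) rel"
  where "seq_equiv C A X = {((B, x, y), (B', x', y')).
    (B, x, y) \<in> seqs C A X \<and> (B', x', y') \<in> seqs C A X \<and>
    (\<exists>b. isomorphism C B B' b \<and> b \<cdot>\<^bsub>C\<^esub> x = x' \<and> y' \<cdot>\<^bsub>C\<^esub> b = y)}"

text \<open>
  In \<open>realiz_sum\<close>, the extension in the conclusion is \<open>\<delta> \<oplus> \<delta>'\<close>, the element of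
  \<open>\<EE>(X \<oplus> X', A \<oplus> A')\<close> with components \<open>\<delta>, 0, 0, \<delta>'\<close>, and its sequence is the direct sum of the
  two given ones.
\<close>

locale extriangulated_category =
  additive_category D + additive_bifunctor D "Ext D" "pull D" "push D"
  for D :: "('o, 'm, 'e, 'z) extri_scheme" (structure) +
  assumes realiz_class: "\<lbrakk>X \<in> Obj D; A \<in> Obj D; \<delta> \<in> carrier (Ext D X A)\<rbrakk>
      \<Longrightarrow> realiz D X A \<delta> \<in> seqs D A X // seq_equiv D A X"
    and realiz_morphism: "\<lbrakk>X \<in> Obj D; A \<in> Obj D; X' \<in> Obj D; A' \<in> Obj D;
        \<delta> \<in> carrier (Ext D X A); \<delta>' \<in> carrier (Ext D X' A');
        (B, x, y) \<in> realiz D X A \<delta>; (B', x', y') \<in> realiz D X' A' \<delta>';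
        a \<in> mor D A A'; c \<in> mor D X X'; push D a \<delta> = pull D c \<delta>'\<rbrakk>
      \<Longrightarrow> \<exists>b\<in>mor D B B'. b \<cdot> x = x' \<cdot> a \<and> y' \<cdot> b = c \<cdot> y"
    and realiz_zero: "\<lbrakk>X \<in> Obj D; A \<in> Obj D; biproduct D A X B i j p q\<rbrakk>
      \<Longrightarrow> (B, i, q) \<in> realiz D X A \<one>\<^bsub>Ext D X A\<^esub>"
    and realiz_sum: "\<lbrakk>X \<in> Obj D; A \<in> Obj D; X' \<in> Obj D; A' \<in> Obj D;
        \<delta> \<in> carrier (Ext D X A); \<delta>' \<in> carrier (Ext D X' A');
        (B, x, y) \<in> realiz D X A \<delta>; (B', x', y') \<in> realiz D X' A' \<delta>';
        biproduct D A A' SA iA iA' pA pA';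
        biproduct D B B' SB iB iB' pB pB';
        biproduct D X X' SX iX iX' pX pX'\<rbrakk>
      \<Longrightarrow> (SB, (iB \<cdot> x \<cdot> pA) \<otimes>\<^bsub>Hom D SA SB\<^esub> (iB' \<cdot> x' \<cdot> pA'),
               (iX \<cdot> y \<cdot> pB) \<otimes>\<^bsub>Hom D SB SX\<^esub> (iX' \<cdot> y' \<cdot> pB'))
          \<in> realiz D SX SA
              (push D iA (pull D pX \<delta>) \<otimes>\<^bsub>Ext D SX SA\<^esub> push D iA' (pull D pX' \<delta>'))"
    and ET3: "\<lbrakk>X \<in> Obj D; A \<in> Obj D; X' \<in> Obj D; A' \<in> Obj D;
        \<delta> \<in> carrier (Ext D X A); \<delta>' \<in> carrier (Ext D X' A');
        (B, x, y) \<in> realiz D X A \<delta>; (B', x', y') \<in> realiz D X' A' \<delta>';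
        a \<in> mor D A A'; b \<in> mor D B B'; b \<cdot> x = x' \<cdot> a\<rbrakk>
      \<Longrightarrow> \<exists>c\<in>mor D X X'. y' \<cdot> b = c \<cdot> y \<and> push D a \<delta> = pull D c \<delta>'"
    and ET3_op: "\<lbrakk>X \<in> Obj D; A \<in> Obj D; X' \<in> Obj D; A' \<in> Obj D;
        \<delta> \<in> carrier (Ext D X A); \<delta>' \<in> carrier (Ext D X' A');
        (B, x, y) \<in> realiz D X A \<delta>; (B', x', y') \<in> realiz D X' A' \<delta>';
        b \<in> mor D B B'; c \<in> mor D X X'; y' \<cdot> b = c \<cdot> y\<rbrakk>
      \<Longrightarrow> \<exists>a\<in>mor D A A'. b \<cdot> x = x' \<cdot> a \<and> push D a \<delta> = pull D c \<delta>'"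
    and ET4: "\<lbrakk>A \<in> Obj D; B \<in> Obj D; X \<in> Obj D; F \<in> Obj D;
        \<delta> \<in> carrier (Ext D X A); \<delta>' \<in> carrier (Ext D F B);
        (B, f, f') \<in> realiz D X A \<delta>; (G, g, g') \<in> realiz D F B \<delta>'\<rbrakk>
      \<Longrightarrow> \<exists>E\<in>Obj D. \<exists>d\<in>mor D X E. \<exists>e\<in>mor D E F. \<exists>h\<in>mor D A G. \<exists>h'\<in>mor D G E.
          \<exists>\<delta>''\<in>carrier (Ext D E A).
            h = g \<cdot> f \<and> h' \<cdot> g = d \<cdot> f' \<and> e \<cdot> h' = g' \<and>
            (G, h, h') \<in> realiz D E A \<delta>'' \<and>
            (E, d, e) \<in> realiz D F X (push D f' \<delta>') \<and>
            pull D d \<delta>'' = \<delta> \<and> push D f \<delta>'' = pull D e \<delta>'"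
    and ET4_op: "\<lbrakk>X \<in> Obj D; B \<in> Obj D; F \<in> Obj D; G \<in> Obj D;
        \<delta> \<in> carrier (Ext D B X); \<delta>' \<in> carrier (Ext D G F);
        (A, f', f) \<in> realiz D B X \<delta>; (B, g', g) \<in> realiz D G F \<delta>'\<rbrakk>
      \<Longrightarrow> \<exists>E\<in>Obj D. \<exists>d\<in>mor D X E. \<exists>e\<in>mor D E F. \<exists>h'\<in>mor D E A. \<exists>h\<in>mor D A G.
          \<exists>\<delta>''\<in>carrier (Ext D G E).
            h = g \<cdot> f \<and> h' \<cdot> d = f' \<and> f \<cdot> h' = g' \<cdot> e \<and>
            (A, h', h) \<in> realiz D G E \<delta>'' \<and>
            (E, d, e) \<in> realiz D F X (pull D g' \<delta>) \<and>
            push D e \<delta>'' = \<delta>' \<and> push D d \<delta> = pull D g \<delta>''"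

definition conflations :: "('o, 'm, 'e, 'z) extri_scheme \<Rightarrow> ('o, 'm) short_seq set"
  where "conflations D = {(A, B, X, x, y). A \<in> Obj D \<and> B \<in> Obj D \<and> X \<in> Obj D \<and>
    (\<exists>\<delta>\<in>carrier (Ext D X A). (B, x, y) \<in> realiz D X A \<delta>)}"

definition conflations_within ::
    "('o, 'm, 'e, 'z) extri_scheme \<Rightarrow> 'o set \<Rightarrow> ('o, 'm) short_seq set"
  where "conflations_within D H =
    {(A, B, X, x, y). (A, B, X, x, y) \<in> conflations D \<and> A \<in> H \<and> B \<in> H \<and> X \<in> H}"


section \<open>Negative first extensions\<close>

text \<open>
  \<open>NExt D X A\<close> is \<open>\<EE>\<^sup>-\<^sup>1(X, A)\<close>. For \<open>\<delta> \<in> \<EE>(X, A)\<close>, the components at \<open>W\<close> of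
  \<open>\<delta>\<^sup>-\<^sup>1 : \<EE>\<^sup>-\<^sup>1(-, X) \<rightarrow> D(-, A)\<close> and \<open>\<delta>\<^sub>-\<^sub>1 : \<EE>\<^sup>-\<^sup>1(A, -) \<rightarrow> D(X, -)\<close> are \<open>conn_contra D X A \<delta> W\<close>
  and \<open>conn_co D X A \<delta> W\<close>.
\<close>

record ('o, 'm, 'e, 'n) neg_extri = "('o, 'm, 'e) extri" +
  NExt :: "'o \<Rightarrow> 'o \<Rightarrow> 'n monoid"
  npull :: "'m \<Rightarrow> 'n \<Rightarrow> 'n"
  npush :: "'m \<Rightarrow> 'n \<Rightarrow> 'n"
  conn_contra :: "'o \<Rightarrow> 'o \<Rightarrow> 'e \<Rightarrow> 'o \<Rightarrow> 'n \<Rightarrow> 'm"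
  conn_co :: "'o \<Rightarrow> 'o \<Rightarrow> 'e \<Rightarrow> 'o \<Rightarrow> 'n \<Rightarrow> 'm"

locale neg_extriangulated_category =
  extriangulated_category D + neg: additive_bifunctor D "NExt D" "npull D" "npush D"
  for D :: "('o, 'm, 'e, 'n, 'z) neg_extri_scheme" (structure) +
  assumes conn_contra_hom: "\<lbrakk>X \<in> Obj D; A \<in> Obj D; W \<in> Obj D; \<delta> \<in> carrier (Ext D X A)\<rbrakk>
      \<Longrightarrow> conn_contra D X A \<delta> W \<in> hom (NExt D W X) (Hom D W A)"
    and conn_contra_natural: "\<lbrakk>X \<in> Obj D; A \<in> Obj D; W \<in> Obj D; W' \<in> Obj D;
        \<delta> \<in> carrier (Ext D X A); w \<in> mor D W' W; e \<in> carrier (NExt D W X)\<rbrakk>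
      \<Longrightarrow> conn_contra D X A \<delta> W' (npull D w e) = conn_contra D X A \<delta> W e \<cdot> w"
    and conn_co_hom: "\<lbrakk>X \<in> Obj D; A \<in> Obj D; W \<in> Obj D; \<delta> \<in> carrier (Ext D X A)\<rbrakk>
      \<Longrightarrow> conn_co D X A \<delta> W \<in> hom (NExt D A W) (Hom D X W)"
    and conn_co_natural: "\<lbrakk>X \<in> Obj D; A \<in> Obj D; W \<in> Obj D; W' \<in> Obj D;
        \<delta> \<in> carrier (Ext D X A); w \<in> mor D W W'; e \<in> carrier (NExt D A W)\<rbrakk>
      \<Longrightarrow> conn_co D X A \<delta> W' (npush D w e) = w \<cdot> conn_co D X A \<delta> W e"
    and exact_contra: "\<lbrakk>X \<in> Obj D; A \<in> Obj D; W \<in> Obj D;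
        \<delta> \<in> carrier (Ext D X A); (B, x, y) \<in> realiz D X A \<delta>\<rbrakk>
      \<Longrightarrow> npush D x ` carrier (NExt D W A) = kernel (NExt D W B) (NExt D W X) (npush D y) \<and>
          npush D y ` carrier (NExt D W B) = kernel (NExt D W X) (Hom D W A) (conn_contra D X A \<delta> W) \<and>
          conn_contra D X A \<delta> W ` carrier (NExt D W X) = kernel (Hom D W A) (Hom D W B) (\<lambda>f. x \<cdot> f)"
    and exact_co: "\<lbrakk>X \<in> Obj D; A \<in> Obj D; W \<in> Obj D;
        \<delta> \<in> carrier (Ext D X A); (B, x, y) \<in> realiz D X A \<delta>\<rbrakk>
      \<Longrightarrow> npull D y ` carrier (NExt D X W) = kernel (NExt D B W) (NExt D A W) (npull D x) \<and>
          npull D x ` carrier (NExt D B W) = kernel (NExt D A W) (Hom D X W) (conn_co D X A \<delta> W) \<and>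
          conn_co D X A \<delta> W ` carrier (NExt D A W) = kernel (Hom D X W) (Hom D B W) (\<lambda>f. f \<cdot> y)"


section \<open>\<open>s\<close>-torsion pairs and intervals\<close>

text \<open>Full subcategories are given by their sets of objects.\<close>

definition replete :: "('o, 'm, 'z) cat_scheme \<Rightarrow> 'o set \<Rightarrow> bool"
  where "replete C S \<longleftrightarrow> S \<subseteq> Obj C \<and>
    (\<forall>A\<in>S. \<forall>B\<in>Obj C. (\<exists>f. isomorphism C A B f) \<longrightarrow> B \<in> S)"

definition vanishes :: "('o \<Rightarrow> 'o \<Rightarrow> 'g monoid) \<Rightarrow> 'o set \<Rightarrow> 'o set \<Rightarrow> bool"
  where "vanishes G S T \<longleftrightarrow> (\<forall>A\<in>S. \<forall>B\<in>T. carrier (G A B) = {\<one>\<^bsub>G A B\<^esub>})"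

definition stors :: "('o, 'm, 'e, 'n, 'z) neg_extri_scheme \<Rightarrow> ('o set \<times> 'o set) set"
  where "stors D = {(T, F). replete D T \<and> replete D F \<and>
    vanishes (Hom D) T F \<and> vanishes (NExt D) T F \<and>
    (\<forall>X\<in>Obj D. \<exists>A\<in>T. \<exists>B\<in>F. \<exists>x y. (A, X, B, x, y) \<in> conflations D)}"

definition stors_le :: "'o set \<times> 'o set \<Rightarrow> 'o set \<times> 'o set \<Rightarrow> bool"
  where "stors_le t t' \<longleftrightarrow> fst t \<subseteq> fst t'"

definition heart :: "'o set \<times> 'o set \<Rightarrow> 'o set \<times> 'o set \<Rightarrow> 'o set"
  where "heart t1 t2 = snd t1 \<inter> fst t2"

definition normal_interval ::
    "('o, 'm, 'e, 'n, 'z) neg_extri_scheme \<Rightarrow> 'o set \<times> 'o set \<Rightarrow> 'o set \<times> 'o set \<Rightarrow> bool"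
  where "normal_interval D t1 t2 \<longleftrightarrow> t1 \<in> stors D \<and> t2 \<in> stors D \<and> stors_le t1 t2 \<and>
    vanishes (NExt D) (fst t2) (snd t1)"

end

(*
  On the heart H = F1 \<inter> T2 the group E^-1(H, H) vanishes, so the long exact sequences turn every
  conflation with terms in H into a kernel-cokernel pair; the remaining axioms of an exact category
  follow from (ET4), pushforward of extensions, and the closure of H under extensions.

  For f : X \<rightarrow> Y in H choose a conflation L \<rightarrow> X \<rightarrow> Y ending in f and a t2-torsion conflation
  K \<rightarrow> L \<rightarrow> F. By (ET4) there are conflations K \<rightarrow> X \<rightarrow> E and F \<rightarrow> E \<rightarrow> Y, where f is the composite
  X \<rightarrow> E \<rightarrow> Y. The torsion axioms put K and E into H, and E \<rightarrow> Y is monic in H because Hom(H, F) = 0.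
  Hence K \<rightarrow> X is a kernel of f and X \<rightarrow> E its coimage. Passing to the opposite category gives the
  cokernel and an epimorphism from X onto the image, and comparing both factorizations of f shows
  that the canonical morphism from the coimage to the image is monic and epic.
*)

theory Submission
  imports Defs
begin


section \<open>Preadditive categories\<close>

context preadditive_category
begin

lemma zero_in: "\<lbrakk>X \<in> Obj C; Y \<in> Obj C\<rbrakk> \<Longrightarrow> zero_mor C X Y \<in> mor C X Y"
  by (meson comm_group.axioms(2) group.is_monoid hom_comm_group monoid.one_closed)

lemma comp_left_hom:
  "\<lbrakk>X \<in> Obj C; Y \<in> Obj C; Z \<in> Obj C; g \<in> mor C Y Z\<rbrakk> \<Longrightarrow> (\<lambda>f. g \<cdot> f) \<in> hom (Hom C X Y) (Hom C X Z)"
  by (auto intro!: homI comp_in[of X Y Z] comp_add_right)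

lemma comp_right_hom:
  "\<lbrakk>X \<in> Obj C; Y \<in> Obj C; Z \<in> Obj C; f \<in> mor C X Y\<rbrakk> \<Longrightarrow> (\<lambda>g. g \<cdot> f) \<in> hom (Hom C Y Z) (Hom C X Z)"
  by (auto intro!: homI comp_in[of X Y Z] comp_add_left)

lemma hom_group: "\<lbrakk>X \<in> Obj C; Y \<in> Obj C\<rbrakk> \<Longrightarrow> group (Hom C X Y)"
  by (simp add: comm_group.axioms(2) hom_comm_group)

lemma comp_zero_right:
  "\<lbrakk>X \<in> Obj C; Y \<in> Obj C; Z \<in> Obj C; g \<in> mor C Y Z\<rbrakk> \<Longrightarrow> g \<cdot> zero_mor C X Y = zero_mor C X Z"
  using hom_one[OF comp_left_hom[of X Y Z g]] hom_group by blast

lemma comp_zero_left: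
  "\<lbrakk>X \<in> Obj C; Y \<in> Obj C; Z \<in> Obj C; f \<in> mor C X Y\<rbrakk> \<Longrightarrow> zero_mor C Y Z \<cdot> f = zero_mor C X Z"
  using hom_one[OF comp_right_hom[of X Y Z f]] hom_group by blast

text \<open>The difference of two morphisms, the hom-groups being written multiplicatively. It turns
  cancellation into the question which single morphism a composition kills.\<close>

definition sub :: "'o \<Rightarrow> 'o \<Rightarrow> 'm \<Rightarrow> 'm \<Rightarrow> 'm"
  where "sub X Y f g = f \<otimes>\<^bsub>Hom C X Y\<^esub> inv\<^bsub>Hom C X Y\<^esub> g"

lemma sub_in: "\<lbrakk>X \<in> Obj C; Y \<in> Obj C; f \<in> mor C X Y; g \<in> mor C X Y\<rbrakk> \<Longrightarrow> sub X Y f g \<in> mor C X Y"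
  unfolding sub_def using hom_group[of X Y] by (simp add: group.is_monoid monoid.m_closed)

lemma sub_eq_zero_iff:
  "\<lbrakk>X \<in> Obj C; Y \<in> Obj C; f \<in> mor C X Y; g \<in> mor C X Y\<rbrakk> \<Longrightarrow> sub X Y f g = zero_mor C X Y \<longleftrightarrow> f = g"
proof -
  assume *: "X \<in> Obj C" "Y \<in> Obj C" "f \<in> mor C X Y" "g \<in> mor C X Y"
  interpret group "Hom C X Y" using * hom_group by blast
  show ?thesis unfolding sub_def using * inv_equality[of f "inv\<^bsub>Hom C X Y\<^esub> g"] by auto
qed

lemma add_in: "\<lbrakk>X \<in> Obj C; Y \<in> Obj C; f \<in> mor C X Y; g \<in> mor C X Y\<rbrakk> \<Longrightarrow> f \<otimes>\<^bsub>Hom C X Y\<^esub> g \<in> mor C X Y"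
  using hom_group[of X Y] by (simp add: group.is_monoid monoid.m_closed)

lemma add_zero:
  assumes "X \<in> Obj C" "Y \<in> Obj C" "f \<in> mor C X Y"
  shows "f \<otimes>\<^bsub>Hom C X Y\<^esub> zero_mor C X Y = f" "zero_mor C X Y \<otimes>\<^bsub>Hom C X Y\<^esub> f = f"
  using hom_group[of X Y] assms by (simp_all add: group.is_monoid monoid.l_one monoid.r_one)

lemma add_sub:
  assumes "X \<in> Obj C" "Y \<in> Obj C" "f \<in> mor C X Y" "g \<in> mor C X Y"
  shows "g \<otimes>\<^bsub>Hom C X Y\<^esub> sub X Y f g = f"
proof -
  interpret comm_group "Hom C X Y" using assms hom_comm_group by blast
  show ?thesis unfolding sub_def using assms by (simp add: m_lcomm[of g f])
qed

lemma comp_sub_right: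
  assumes "X \<in> Obj C" "Y \<in> Obj C" "Z \<in> Obj C" "f \<in> mor C X Y" "f' \<in> mor C X Y" "g \<in> mor C Y Z"
  shows "g \<cdot> sub X Y f f' = sub X Z (g \<cdot> f) (g \<cdot> f')"
proof -
  interpret group_hom "Hom C X Y" "Hom C X Z" "\<lambda>f. g \<cdot> f"
    using assms hom_group comp_left_hom by (simp add: group_hom_axioms.intro group_hom_def)
  show ?thesis unfolding sub_def using assms by simp
qed

lemma comp_sub_left:
  assumes "X \<in> Obj C" "Y \<in> Obj C" "Z \<in> Obj C" "f \<in> mor C X Y" "g \<in> mor C Y Z" "g' \<in> mor C Y Z"
  shows "sub Y Z g g' \<cdot> f = sub X Z (g \<cdot> f) (g' \<cdot> f)"
proof -
  interpret group_hom "Hom C Y Z" "Hom C X Z" "\<lambda>g. g \<cdot> f"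
    using assms hom_group comp_right_hom by (simp add: group_hom_axioms.intro group_hom_def)
  show ?thesis unfolding sub_def using assms by simp
qed

section \<open>Zero objects, biproducts and isomorphisms\<close>

lemma zero_object_mor:
  assumes "zero_object C Z" "X \<in> Obj C"
  shows "mor C X Z = {zero_mor C X Z}" "mor C Z X = {zero_mor C Z X}"
  using assms zero_in[of X Z] zero_in[of Z X] unfolding zero_object_def by blast+

text \<open>Feeds \<open>realiz_zero\<close>: it makes A -> A -> 0 and, after exchanging the
  summands, 0 -> A -> A available as conflations to compare others with.\<close>

lemma biproduct_zero_right:
  assumes "zero_object C Z" "A \<in> Obj C"
  shows "biproduct C A Z A (ide C A) (zero_mor C Z A) (ide C A) (zero_mor C A Z)"
proof -
  have Z: "Z \<in> Obj C" using assms by (simp add: zero_object_def)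
  have "ide C Z = zero_mor C Z Z" using zero_object_mor(1)[OF assms(1) Z] ide_in[OF Z] by simp
  then show ?thesis
    using assms Z unfolding biproduct_def
    by (simp add: ide_in zero_in comp_ide_right[of A A] comp_ide_left[of Z A] comp_ide_right[of A Z]
        comp_zero_right[of Z A Z] comp_zero_right[of A Z A] add_zero)
qed

lemma biproduct_sym:
  assumes "A \<in> Obj C" "B \<in> Obj C" "biproduct C A B S i j p q"
  shows "biproduct C B A S j i q p"
proof -
  have "S \<in> Obj C" "i \<cdot> p \<in> mor C S S" "j \<cdot> q \<in> mor C S S"
    using assms comp_in[of S A S] comp_in[of S B S] by (auto simp: biproduct_def)
  then show ?thesis
    using assms comm_monoid.m_comm[OF comm_group.axioms(1)[OF hom_comm_group[of S S]]]
    by (auto simp: biproduct_def)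
qed

lemma isomorphism_ide: "A \<in> Obj C \<Longrightarrow> isomorphism C A A (ide C A)"
  unfolding isomorphism_def using ide_in comp_ide_right by blast

lemma isomorphism_inverse:
  assumes "isomorphism C A B f"
  obtains g where "isomorphism C B A g" "f \<in> mor C A B" "g \<in> mor C B A"
    "g \<cdot> f = ide C A" "f \<cdot> g = ide C B"
  using assms unfolding isomorphism_def by blast

lemma isomorphism_comp:
  assumes "A \<in> Obj C" "B \<in> Obj C" "Z \<in> Obj C" "isomorphism C A B f" "isomorphism C B Z g"
  shows "isomorphism C A Z (g \<cdot> f)"
proof -
  obtain f' where f: "f \<in> mor C A B" "f' \<in> mor C B A" "f' \<cdot> f = ide C A" "f \<cdot> f' = ide C B"
    using assms(4) by (rule isomorphism_inverse)
  obtain g' where g: "g \<in> mor C B Z" "g' \<in> mor C Z B" "g' \<cdot> g = ide C B" "g \<cdot> g' = ide C Z"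
    using assms(5) by (rule isomorphism_inverse)
  have gf: "g \<cdot> f \<in> mor C A Z" "f' \<cdot> g' \<in> mor C Z A"
    using assms(1-3) f g comp_in[of A B Z] comp_in[of Z B A] by blast+
  have "(f' \<cdot> g') \<cdot> (g \<cdot> f) = f' \<cdot> ((g' \<cdot> g) \<cdot> f)"
    using assms(1-3) f g gf comp_assoc[of A Z B A "g \<cdot> f" g' f'] comp_assoc[of A B Z B f g g'] by simp
  moreover have "(g \<cdot> f) \<cdot> (f' \<cdot> g') = g \<cdot> ((f \<cdot> f') \<cdot> g')"
    using assms(1-3) f g gf comp_assoc[of Z A B Z "f' \<cdot> g'" f g] comp_assoc[of Z B A B g' f' f] by simp
  ultimately show ?thesis
    unfolding isomorphism_def using assms(1-3) f g gf comp_ide_left[of A B f] comp_ide_left[of Z B g']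
    by auto
qed

text \<open>If \<open>b = 1 + n\<close> with \<open>n\<^sup>2 = 0\<close>, then \<open>1 - n\<close> is inverse to \<open>b\<close>.\<close>

lemma isomorphism_if_square_zero:
  assumes B: "B \<in> Obj C" and b: "b \<in> mor C B B"
    and sq: "sub B B b (ide C B) \<cdot> sub B B b (ide C B) = zero_mor C B B"
  shows "isomorphism C B B b"
proof -
  interpret H: comm_group "Hom C B B" using B hom_comm_group by blast
  define n where "n = sub B B b (ide C B)"
  define c where "c = sub B B (ide C B) n"
  have n: "n \<in> mor C B B" and c: "c \<in> mor C B B"
    using B b by (simp_all add: n_def c_def sub_in ide_in)
  have bn: "b = ide C B \<otimes>\<^bsub>Hom C B B\<^esub> n"
    unfolding n_def using B b add_sub[of B B b "ide C B"] ide_in by simp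
  \<comment> \<open>As \<open>n\<close> squares to zero, multiplying \<open>c = 1 - n\<close> by
    \<open>n\<close> on either side returns \<open>n\<close>, so \<open>b \<cdot> c\<close> and
    \<open>c \<cdot> b\<close> both reduce to \<open>n + c = 1\<close>.\<close>
  have nc: "n \<cdot> c = n" "c \<cdot> n = n"
    unfolding c_def using B n sq ide_in
    by (simp_all add: comp_sub_right[of B B B] comp_sub_left[of B B B] n_def[symmetric]
        comp_ide_left[of B B] comp_ide_right[of B B]) (simp_all add: sub_def)
  have "n \<otimes>\<^bsub>Hom C B B\<^esub> c = ide C B"
    unfolding c_def using B n add_sub[of B B "ide C B" n] ide_in by simp
  then have "b \<cdot> c = ide C B" "c \<cdot> b = ide C B"
    using B n c ide_in nc H.m_comm
    by (simp_all add: bn comp_add_left[of B B B] comp_add_right[of B B B]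
        comp_ide_left[of B B] comp_ide_right[of B B])
  then show ?thesis using b c by (auto simp: isomorphism_def)
qed

end


section \<open>Duality\<close>

text \<open>The record type is that of \<open>D\<close>, so any lemma about an arbitrary
  \<open>neg_extriangulated_category\<close> can be instantiated here. The dual halves of the
  argument are obtained in this way.\<close>

definition opposite :: "('o, 'm, 'e, 'n, 'z) neg_extri_scheme \<Rightarrow> ('o, 'm, 'e, 'n, 'z) neg_extri_scheme"
  where "opposite D = D\<lparr>Hom := \<lambda>X Y. Hom D Y X, comp := \<lambda>g f. f \<cdot>\<^bsub>D\<^esub> g,
    Ext := \<lambda>X A. Ext D A X, pull := push D, push := pull D,
    realiz := \<lambda>X A \<delta>. {(B, x, y). (B, y, x) \<in> realiz D A X \<delta>},
    NExt := \<lambda>X A. NExt D A X, npull := npush D, npush := npull D,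
    conn_contra := \<lambda>X A. conn_co D A X, conn_co := \<lambda>X A. conn_contra D A X\<rparr>"

lemma opposite_simps [simp]:
  "Obj (opposite D) = Obj D"
  "Hom (opposite D) X Y = Hom D Y X"
  "ide (opposite D) X = ide D X"
  "g \<cdot>\<^bsub>opposite D\<^esub> f = f \<cdot>\<^bsub>D\<^esub> g"
  "Ext (opposite D) X Y = Ext D Y X"
  "pull (opposite D) = push D"
  "push (opposite D) = pull D"
  "(B, x, y) \<in> realiz (opposite D) X A \<delta> \<longleftrightarrow> (B, y, x) \<in> realiz D A X \<delta>"
  "NExt (opposite D) X Y = NExt D Y X"
  "npull (opposite D) = npush D"
  "npush (opposite D) = npull D"
  "conn_contra (opposite D) X Y = conn_co D Y X"
  "conn_co (opposite D) X Y = conn_contra D Y X"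
  by (simp_all add: opposite_def)

text \<open>As simp rules, these rewrite an instance of a lemma at \<open>opposite D\<close> into
  the dual statement about \<open>D\<close>.\<close>

lemma opposite_predicates [simp]:
  "zero_object (opposite D) Z \<longleftrightarrow> zero_object D Z"
  "biproduct (opposite D) A B S i j p q \<longleftrightarrow> biproduct D A B S p q i j"
  "isomorphism (opposite D) A B f \<longleftrightarrow> isomorphism D B A f"
  "monomorphism (opposite D) A B f \<longleftrightarrow> epimorphism D B A f"
  "epimorphism (opposite D) A B f \<longleftrightarrow> monomorphism D B A f"
  "is_kernel (opposite D) X Y f K k \<longleftrightarrow> is_cokernel D Y X f K k"
  "is_cokernel (opposite D) X Y f K k \<longleftrightarrow> is_kernel D Y X f K k"
  "is_pushout (opposite D) A B A' i f P i' f' \<longleftrightarrow> is_pullback D A B A' i f P i' f'"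
  "is_pullback (opposite D) A B A' i f P i' f' \<longleftrightarrow> is_pushout D A B A' i f P i' f'"
  "(A, B, X, x, y) \<in> conflations (opposite D) \<longleftrightarrow> (X, B, A, y, x) \<in> conflations D"
  "(A, B, X, x, y) \<in> conflations_within (opposite D) U \<longleftrightarrow> (X, B, A, y, x) \<in> conflations_within D U"
  "full_subcategory (opposite D) U = opposite (full_subcategory D U)"
  by (auto simp: zero_object_def biproduct_def isomorphism_def monomorphism_def epimorphism_def
      is_kernel_def is_cokernel_def is_pushout_def is_pullback_def conflations_def
      conflations_within_def opposite_def full_subcategory_def)

lemma replete_opposite [simp]: "replete (opposite D) U = replete D U"
proof -
  have "(\<exists>f. isomorphism D B A f) \<longleftrightarrow> (\<exists>f. isomorphism D A B f)" for A B
    by (auto simp: isomorphism_def)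
  then show ?thesis by (simp add: replete_def)
qed

lemma vanishes_opposite [simp]:
  "vanishes (Hom (opposite D)) S T = vanishes (Hom D) T S"
  "vanishes (NExt (opposite D)) S T = vanishes (NExt D) T S"
  by (auto simp: vanishes_def)

section \<open>Sequences with fixed ends up to equivalence\<close>

lemma (in preadditive_category) seq_equiv_sym:
  assumes "A \<in> Obj C" "X \<in> Obj C" "(s, t) \<in> seq_equiv C A X"
  shows "(t, s) \<in> seq_equiv C A X"
proof -
  obtain B x y B' x' y' b where *: "s = (B, x, y)" "t = (B', x', y')"
      "B \<in> Obj C" "x \<in> mor C A B" "y \<in> mor C B X" "B' \<in> Obj C" "x' \<in> mor C A B'" "y' \<in> mor C B' X"
      "isomorphism C B B' b" "b \<cdot> x = x'" "y' \<cdot> b = y"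
    using assms(3) unfolding seq_equiv_def seqs_def by fast
  obtain b' where b: "isomorphism C B' B b'" "b \<in> mor C B B'" "b' \<in> mor C B' B"
      "b' \<cdot> b = ide C B" "b \<cdot> b' = ide C B'"
    using *(9) by (rule isomorphism_inverse)
  have "b' \<cdot> x' = x"
    using * b assms comp_assoc[of A B B' B x b b'] comp_ide_left[of A B x] by simp
  moreover have "y \<cdot> b' = y'"
    using * b assms comp_assoc[of B' B B' X b' b y'] comp_ide_right[of B' X y'] by simp
  ultimately show ?thesis
    unfolding seq_equiv_def seqs_def using * b(1) by auto
qed

lemma (in preadditive_category) seq_equiv_trans:
  assumes "A \<in> Obj C" "X \<in> Obj C" "(s, t) \<in> seq_equiv C A X" "(t, r) \<in> seq_equiv C A X"
  shows "(s, r) \<in> seq_equiv C A X"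
proof -
  obtain B x y B' x' y' b where *: "s = (B, x, y)" "t = (B', x', y')"
      "B \<in> Obj C" "x \<in> mor C A B" "y \<in> mor C B X" "B' \<in> Obj C" "x' \<in> mor C A B'" "y' \<in> mor C B' X"
      "isomorphism C B B' b" "b \<cdot> x = x'" "y' \<cdot> b = y"
    using assms(3) unfolding seq_equiv_def seqs_def by fast
  obtain B'' x'' y'' b' where **: "r = (B'', x'', y'')"
      "B'' \<in> Obj C" "x'' \<in> mor C A B''" "y'' \<in> mor C B'' X"
      "isomorphism C B' B'' b'" "b' \<cdot> x' = x''" "y'' \<cdot> b' = y'"
    using assms(4) unfolding seq_equiv_def seqs_def *(2) by blast
  have b: "b \<in> mor C B B'" "b' \<in> mor C B' B''" using * ** by (auto simp: isomorphism_def)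
  have "(b' \<cdot> b) \<cdot> x = x''"
    using * ** b assms comp_assoc[of A B B' B'' x b b'] by simp
  moreover have "y'' \<cdot> (b' \<cdot> b) = y"
    using * ** b assms comp_assoc[of B B' B'' X b b' y''] by simp
  ultimately show ?thesis
    unfolding seq_equiv_def seqs_def using * ** isomorphism_comp[of B B' B'' b b'] by auto
qed

lemma (in preadditive_category) seq_equiv_refl:
  assumes "A \<in> Obj C" "X \<in> Obj C" "s \<in> seqs C A X"
  shows "(s, s) \<in> seq_equiv C A X"
proof -
  obtain B x y where *: "s = (B, x, y)" "B \<in> Obj C" "x \<in> mor C A B" "y \<in> mor C B X"
    using assms(3) unfolding seqs_def by blast
  have "isomorphism C B B (ide C B) \<and> ide C B \<cdot> x = x \<and> y \<cdot> ide C B = y"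
    using * assms isomorphism_ide comp_ide_left[of A B x] comp_ide_right[of B X y] by simp
  then show ?thesis using * unfolding seq_equiv_def seqs_def by blast
qed

context neg_extriangulated_category
begin

text \<open>Reversing arrows also reverses the isomorphism between the middle terms; symmetry of the
  equivalence undoes this.\<close>

lemma seq_equiv_opposite:
  assumes "A \<in> Obj D" "X \<in> Obj D"
  shows "((B, x, y), (B', x', y')) \<in> seq_equiv (opposite D) X A \<longleftrightarrow>
    ((B, y, x), (B', y', x')) \<in> seq_equiv D A X"
proof -
  have "((B, x, y), (B', x', y')) \<in> seq_equiv (opposite D) X A \<longleftrightarrow>
      ((B', y', x'), (B, y, x)) \<in> seq_equiv D A X"
    by (auto simp: seq_equiv_def seqs_def)
  then show ?thesis using seq_equiv_sym assms by blast
qed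

lemma realizD:
  assumes "X \<in> Obj D" "A \<in> Obj D" "\<delta> \<in> carrier (Ext D X A)" "(B, x, y) \<in> realiz D X A \<delta>"
  shows "B \<in> Obj D" "x \<in> mor D A B" "y \<in> mor D B X"
  using realiz_class[OF assms(1-3)] assms(4)
  by (auto simp: quotient_def seq_equiv_def seqs_def)

lemma realiz_nonempty:
  assumes "X \<in> Obj D" "A \<in> Obj D" "\<delta> \<in> carrier (Ext D X A)"
  obtains B x y where "(B, x, y) \<in> realiz D X A \<delta>"
proof -
  obtain s where "s \<in> seqs D A X" "realiz D X A \<delta> = seq_equiv D A X `` {s}"
    using realiz_class[OF assms] by (auto simp: quotient_def)
  then have "s \<in> realiz D X A \<delta>" using seq_equiv_refl assms by auto
  then show ?thesis using that by (cases s) auto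
qed

text \<open>Any one member determines the whole class. This gives the class condition for the
  opposite category and later allows one realization to be replaced by an equivalent one.\<close>

lemma realiz_equiv:
  assumes "X \<in> Obj D" "A \<in> Obj D" "\<delta> \<in> carrier (Ext D X A)" "s \<in> realiz D X A \<delta>"
  shows "t \<in> realiz D X A \<delta> \<longleftrightarrow> (s, t) \<in> seq_equiv D A X"
proof -
  obtain r where r: "realiz D X A \<delta> = seq_equiv D A X `` {r}"
    using realiz_class[OF assms(1-3)] by (auto simp: quotient_def)
  show ?thesis
    using assms(1,2,4) seq_equiv_sym[OF assms(2,1)] seq_equiv_trans[OF assms(2,1)] unfolding r by blast
qed

section \<open>The axioms for the opposite category\<close>

lemma preadditive_opposite: "preadditive_category (opposite D)"
proof (intro preadditive_category.intro, goal_cases)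
  case 1 then show ?case by (simp add: hom_comm_group)
next
  case 2 then show ?case by (simp add: ide_in)
next
  case (3 X Y Z f g) then show ?case using comp_in[of Z Y X g f] by simp
next
  case 4 then show ?case by (simp add: comp_ide_left)
next
  case 5 then show ?case by (simp add: comp_ide_right)
next
  case (6 W X Y Z f g h) then show ?case using comp_assoc[of Z Y X W h g f] by simp
next
  case (7 X Y Z f f' g) then show ?case using comp_add_left[of Z Y X g f f'] by simp
next
  case (8 X Y Z f g g') then show ?case using comp_add_right[of Z Y X g g' f] by simp
qed

lemma additive_opposite: "additive_category (opposite D)"
proof (intro additive_category.intro preadditive_opposite additive_category_axioms.intro, goal_cases)
  case 1 then show ?case using has_zero_object by simp
next
  case (2 A B) then show ?case using has_biproducts[of A B] by simp blast
qed

lemma Ext_opposite: "additive_bifunctor (opposite D) (Ext (opposite D)) (pull (opposite D)) (push (opposite D))"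
proof (intro additive_bifunctor.intro preadditive_opposite additive_bifunctor_axioms.intro, goal_cases)
  case (1 X A) then show ?case by (simp add: val_comm_group)
next
  case 2 then show ?case by (simp add: pf_hom)
next
  case 3 then show ?case by (simp add: pb_hom)
next
  case 4 then show ?case by (simp add: pf_ide)
next
  case 5 then show ?case by (simp add: pb_ide)
next
  case 6 then show ?case by (simp add: pf_comp)
next
  case 7 then show ?case by (simp add: pb_comp)
next
  case 8 then show ?case by (simp add: pb_pf)
next
  case 9 then show ?case by (simp add: pf_add)
next
  case 10 then show ?case by (simp add: pb_add)
qed

lemma NExt_opposite: "additive_bifunctor (opposite D) (NExt (opposite D)) (npull (opposite D)) (npush (opposite D))"
proof (intro additive_bifunctor.intro preadditive_opposite additive_bifunctor_axioms.intro, goal_cases)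
  case 1 then show ?case by (simp add: neg.val_comm_group)
next
  case 2 then show ?case by (simp add: neg.pf_hom)
next
  case 3 then show ?case by (simp add: neg.pb_hom)
next
  case 4 then show ?case by (simp add: neg.pf_ide)
next
  case 5 then show ?case by (simp add: neg.pb_ide)
next
  case 6 then show ?case by (simp add: neg.pf_comp)
next
  case 7 then show ?case by (simp add: neg.pb_comp)
next
  case 8 then show ?case by (simp add: neg.pb_pf)
next
  case 9 then show ?case by (simp add: neg.pf_add)
next
  case 10 then show ?case by (simp add: neg.pb_add)
qed

text \<open>The axioms come in mirror pairs: ET3 and ET4 trade places with their opposites, and the
  axioms on realizations are self-dual up to equivalence of sequences and rearrangement of
  sums.\<close>

lemma extriangulated_opposite: "extriangulated_category (opposite D)"
proof (intro extriangulated_category.intro additive_opposite Ext_opposite extriangulated_category_axioms.intro, goal_cases)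
  case (1 X A \<delta>)
  then have *: "X \<in> Obj D" "A \<in> Obj D" "\<delta> \<in> carrier (Ext D A X)" by simp_all
  obtain B x y where s: "(B, x, y) \<in> realiz D A X \<delta>"
    using realiz_nonempty * by metis
  have "realiz (opposite D) X A \<delta> = seq_equiv (opposite D) A X `` {(B, y, x)}"
    using realiz_equiv[OF *(2,1,3) s] seq_equiv_opposite[OF *(1,2)] by auto
  moreover have "(B, y, x) \<in> seqs (opposite D) A X"
    using realizD[OF *(2,1,3) s] by (simp add: seqs_def)
  ultimately show ?case by (auto simp: quotient_def)
next
  case (2 X A X' A' \<delta> \<delta>' B x y B' x' y' a c)
  then show ?case using realiz_morphism[of A' X' A X \<delta>' \<delta> B' y' x' B y x c a] by auto
next
  case (3 X A B i j p q)
  then show ?case using realiz_zero[of A X B q p j i] biproduct_sym by simp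
next
  case (4 X A X' A' \<delta> \<delta>' B x y B' x' y' SA iA iA' pA pA' SB iB iB' pB pB' SX iX iX' pX pX')
  then have *: "X \<in> Obj D" "A \<in> Obj D" "X' \<in> Obj D" "A' \<in> Obj D"
      "\<delta> \<in> carrier (Ext D A X)" "\<delta>' \<in> carrier (Ext D A' X')"
      "(B, y, x) \<in> realiz D A X \<delta>" "(B', y', x') \<in> realiz D A' X' \<delta>'"
      "biproduct D A A' SA pA pA' iA iA'" "biproduct D B B' SB pB pB' iB iB'"
      "biproduct D X X' SX pX pX' iX iX'"
    by simp_all
  note r = realizD[OF *(2,1,5,7)] realizD[OF *(4,3,6,8)]
  note bi = *(9-11)[unfolded biproduct_def]
  \<comment> \<open>Reversal turns the right-nested composites of \<open>realiz_sum\<close> into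
    left-nested ones and swaps the order of \<open>push\<close> and \<open>pull\<close>;
    associativity and bifunctoriality restore the required form.\<close>
  have "(pA \<cdot> x) \<cdot> iB = pA \<cdot> (x \<cdot> iB)" "(pA' \<cdot> x') \<cdot> iB' = pA' \<cdot> (x' \<cdot> iB')"
      "(pB \<cdot> y) \<cdot> iX = pB \<cdot> (y \<cdot> iX)" "(pB' \<cdot> y') \<cdot> iX' = pB' \<cdot> (y' \<cdot> iX')"
    using comp_assoc[of SB B A SA iB x pA] comp_assoc[of SB B' A' SA iB' x' pA']
      comp_assoc[of SX X B SB iX y pB] comp_assoc[of SX X' B' SB iX' y' pB'] * r bi by blast+
  moreover have "push D pX (pull D iA \<delta>) = pull D iA (push D pX \<delta>)"
      "push D pX' (pull D iA' \<delta>') = pull D iA' (push D pX' \<delta>')"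
    using pb_pf[of A SA X SX iA pX \<delta>] pb_pf[of A' SA X' SX iA' pX' \<delta>'] * bi by simp_all
  ultimately show ?case
    using realiz_sum[OF *(2,1,4,3,5-8,11,10,9)] by simp
next
  case (5 X A X' A' \<delta> \<delta>' B x y B' x' y' a b)
  then show ?case using ET3_op[of A' X' A X \<delta>' \<delta> B' y' x' B y x b a] by auto
next
  case (6 X A X' A' \<delta> \<delta>' B x y B' x' y' b c)
  then show ?case using ET3[of A' X' A X \<delta>' \<delta> B' y' x' B y x c b] by auto
next
  case (7 A B X F \<delta> \<delta>' f f' G g g')
  then show ?case using ET4_op[of F B X A \<delta>' \<delta> G g' g f' f] by simp metis
next
  case (8 X B F G \<delta> \<delta>' A f' f g' g)
  then show ?case using ET4[of G B F X \<delta>' \<delta> g g' A f f'] by simp metis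
qed

lemma dual: "neg_extriangulated_category (opposite D)"
proof (intro neg_extriangulated_category.intro extriangulated_opposite NExt_opposite neg_extriangulated_category_axioms.intro, goal_cases)
  case 1 then show ?case by (simp add: conn_co_hom)
next
  case 2 then show ?case by (simp add: conn_co_natural)
next
  case 3 then show ?case by (simp add: conn_contra_hom)
next
  case 4 then show ?case by (simp add: conn_contra_natural)
next
  case 5 then show ?case using exact_co by simp
next
  case 6 then show ?case using exact_contra by simp
qed

end


section \<open>Conflations\<close>

context neg_extriangulated_category
begin

lemma conflationD:
  assumes "(A, B, X, x, y) \<in> conflations D"
  shows "A \<in> Obj D" "B \<in> Obj D" "X \<in> Obj D" "x \<in> mor D A B" "y \<in> mor D B X"
  using assms realizD[of X A] by (auto simp: conflations_def)

lemma conflationE: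
  assumes "(A, B, X, x, y) \<in> conflations D"
  obtains \<delta> where "\<delta> \<in> carrier (Ext D X A)" "(B, x, y) \<in> realiz D X A \<delta>"
  using assms by (auto simp: conflations_def)

lemma conflationI:
  assumes "X \<in> Obj D" "A \<in> Obj D" "\<delta> \<in> carrier (Ext D X A)" "(B, x, y) \<in> realiz D X A \<delta>"
  shows "(A, B, X, x, y) \<in> conflations D"
  using assms realizD(1)[OF assms] by (auto simp: conflations_def)

lemma Ext_zero_in: "\<lbrakk>X \<in> Obj D; A \<in> Obj D\<rbrakk> \<Longrightarrow> \<one>\<^bsub>Ext D X A\<^esub> \<in> carrier (Ext D X A)"
  by (meson comm_group.axioms(2) group.is_monoid monoid.one_closed val_comm_group)

lemma pull_zero:
  "\<lbrakk>X \<in> Obj D; Y \<in> Obj D; A \<in> Obj D; c \<in> mor D Y X\<rbrakk> \<Longrightarrow> pull D c \<one>\<^bsub>Ext D X A\<^esub> = \<one>\<^bsub>Ext D Y A\<^esub>"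
  by (meson comm_group.axioms(2) hom_one pb_hom val_comm_group)

lemma pull_in:
  "\<lbrakk>X \<in> Obj D; Y \<in> Obj D; A \<in> Obj D; c \<in> mor D Y X; e \<in> carrier (Ext D X A)\<rbrakk>
    \<Longrightarrow> pull D c e \<in> carrier (Ext D Y A)"
  using hom_in_carrier[OF pb_hom] by blast

lemma push_in:
  "\<lbrakk>X \<in> Obj D; A \<in> Obj D; B \<in> Obj D; a \<in> mor D A B; e \<in> carrier (Ext D X A)\<rbrakk>
    \<Longrightarrow> push D a e \<in> carrier (Ext D X B)"
  using hom_in_carrier[OF pf_hom] by blast

section \<open>Conflations with a zero term, weak kernels and weak cokernels\<close>

lemma realiz_ide:
  assumes "zero_object D Z" "A \<in> Obj D"
  shows "(A, ide D A, zero_mor D A Z) \<in> realiz D Z A \<one>\<^bsub>Ext D Z A\<^esub>"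
  using realiz_zero[OF _ assms(2) biproduct_zero_right[OF assms]] assms
  by (simp add: zero_object_def)

lemma conflation_ide:
  assumes "zero_object D Z" "A \<in> Obj D"
  shows "(A, A, Z, ide D A, zero_mor D A Z) \<in> conflations D"
  using conflationI[OF _ assms(2) Ext_zero_in realiz_ide[OF assms]] assms by (simp add: zero_object_def)

text \<open>By ET3 the morphisms \<open>x\<close> and \<open>ide D B\<close> extend to a morphism
  into the conflation B -> B -> 0, so the pushed extension is also pulled back from the zero
  extension over a zero object.\<close>

lemma push_inflation_zero:
  assumes "X \<in> Obj D" "A \<in> Obj D" "\<delta> \<in> carrier (Ext D X A)" "(B, x, y) \<in> realiz D X A \<delta>"
  shows "push D x \<delta> = \<one>\<^bsub>Ext D X B\<^esub>"
proof -
  obtain Z where Z: "zero_object D Z" using has_zero_object by blast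
  note r = realizD[OF assms]
  obtain c where "c \<in> mor D X Z" "push D x \<delta> = pull D c \<one>\<^bsub>Ext D Z B\<^esub>"
    using ET3[OF assms(1,2) _ r(1) assms(3) Ext_zero_in assms(4) realiz_ide[OF Z r(1)] r(2) ide_in[OF r(1)]]
      Z r comp_ide_left[of A B x] assms(2) by (auto simp: zero_object_def)
  then show ?thesis using pull_zero r assms Z by (simp add: zero_object_def)
qed

text \<open>ET3, applied from A -> A -> 0 with the identity and \<open>x\<close>, factors
  \<open>y \<cdot> x\<close> through a zero object.\<close>

lemma conflation_comp:
  assumes "(A, B, X, x, y) \<in> conflations D"
  shows "y \<cdot> x = zero_mor D A X"
proof -
  obtain Z where Z: "zero_object D Z" using has_zero_object by blast
  then have ZO: "Z \<in> Obj D" by (simp add: zero_object_def)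
  note c = conflationD[OF assms]
  obtain \<delta> where \<delta>: "\<delta> \<in> carrier (Ext D X A)" "(B, x, y) \<in> realiz D X A \<delta>"
    using assms by (rule conflationE)
  obtain u where u: "u \<in> mor D Z X" "y \<cdot> x = u \<cdot> zero_mor D A Z"
    using ET3[OF ZO c(1) c(3) c(1) Ext_zero_in[OF ZO c(1)] \<delta>(1) realiz_ide[OF Z c(1)] \<delta>(2)
        ide_in[OF c(1)] c(4)] by auto
  then show ?thesis using comp_zero_right[OF c(1) ZO c(3) u(1)] by simp
qed

text \<open>Since \<open>f\<close> kills \<open>x\<close>, ET3 provides a morphism into the
  conflation 0 -> W -> W with \<open>f\<close> in the middle, and its last component is
  \<open>g\<close>. Uniqueness of \<open>g\<close> is a separate matter, settled by negative
  extensions.\<close>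

lemma weak_cokernel:
  assumes "(A, B, X, x, y) \<in> conflations D" "W \<in> Obj D" "f \<in> mor D B W"
    and "f \<cdot> x = zero_mor D A W"
  obtains g where "g \<in> mor D X W" "g \<cdot> y = f"
proof -
  obtain Z where Z: "zero_object D Z" using has_zero_object by blast
  then have ZO: "Z \<in> Obj D" by (simp add: zero_object_def)
  note c = conflationD[OF assms(1)]
  obtain \<delta> where \<delta>: "\<delta> \<in> carrier (Ext D X A)" "(B, x, y) \<in> realiz D X A \<delta>"
    using assms(1) by (rule conflationE)
  have r: "(W, zero_mor D Z W, ide D W) \<in> realiz D W Z \<one>\<^bsub>Ext D W Z\<^esub>"
    using realiz_zero[OF assms(2) ZO] biproduct_sym[OF assms(2) ZO biproduct_zero_right[OF Z assms(2)]]
    by blast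
  have "f \<cdot> x = zero_mor D Z W \<cdot> zero_mor D A Z"
    using assms(2,4) c(1) ZO by (simp add: comp_zero_left[of A Z W] zero_in)
  then obtain g where g: "g \<in> mor D X W" "ide D W \<cdot> f = g \<cdot> y"
    using ET3[OF c(3,1) assms(2) ZO \<delta>(1) Ext_zero_in[OF assms(2) ZO] \<delta>(2) r zero_in[OF c(1) ZO] assms(3)]
    by auto
  show ?thesis using that[OF g(1)] g(2) comp_ide_left[OF c(2) assms(2,3)] by simp
qed

lemma weak_kernel:
  assumes "(A, B, X, x, y) \<in> conflations D" "W \<in> Obj D" "f \<in> mor D W B"
    and "y \<cdot> f = zero_mor D W X"
  obtains g where "g \<in> mor D W A" "x \<cdot> g = f"
  using neg_extriangulated_category.weak_cokernel[OF dual, of X B A y x W f] assms by auto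

text \<open>A morphism of conflations that is the identity at both ends differs from the identity by
  an \<open>n\<close> which factors through \<open>y\<close> and through \<open>x\<close>, whence \<open>n\<^sup>2 = 0\<close>.\<close>

lemma five_lemma_endo:
  assumes c: "(A, B, X, x, y) \<in> conflations D" and b: "b \<in> mor D B B" "b \<cdot> x = x" "y \<cdot> b = y"
  shows "isomorphism D B B b"
proof -
  note c' = conflationD[OF c]
  note i = ide_in[OF c'(2)]
  define n where "n = sub B B b (ide D B)"
  have n: "n \<in> mor D B B" using c' b i by (simp add: n_def sub_in)
  have "n \<cdot> x = sub A B x x"
    unfolding n_def using c' b i comp_sub_left[of A B B x b "ide D B"] comp_ide_left[of A B x] by simp
  then have "n \<cdot> x = zero_mor D A B" using sub_eq_zero_iff c' by simp
  then obtain v where v: "v \<in> mor D X B" "v \<cdot> y = n"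
    using weak_cokernel[OF c c'(2) n] by blast
  have "y \<cdot> n = sub B X y y"
    unfolding n_def using c' b i comp_sub_right[of B B X b "ide D B" y] comp_ide_right[of B X y] by simp
  then have "y \<cdot> n = zero_mor D B X" using sub_eq_zero_iff c' by simp
  then have "n \<cdot> n = zero_mor D B B"
    using v n c' comp_assoc[of B B X B n y v] comp_zero_right[of B X B v] by simp
  then show ?thesis using isomorphism_if_square_zero c' b unfolding n_def by blast
qed

text \<open>One hypothesis gives \<open>f\<close> a left inverse, the other a right inverse, and
  these coincide.\<close>

lemma isomorphism_if_left_right_inverse:
  assumes "A \<in> Obj D" "B \<in> Obj D" "f \<in> mor D A B" "g \<in> mor D B A"
    and "isomorphism D A A (g \<cdot> f)" "isomorphism D B B (f \<cdot> g)"
  shows "isomorphism D A B f"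
proof -
  obtain r where r: "g \<cdot> f \<in> mor D A A" "r \<in> mor D A A" "r \<cdot> (g \<cdot> f) = ide D A"
    using assms(5) by (rule isomorphism_inverse)
  obtain s where s: "f \<cdot> g \<in> mor D B B" "s \<in> mor D B B" "(f \<cdot> g) \<cdot> s = ide D B"
    using assms(6) by (rule isomorphism_inverse)
  have rg: "r \<cdot> g \<in> mor D B A" "g \<cdot> s \<in> mor D B A"
    using assms r s comp_in[of B A A] comp_in[of B B A] by auto
  have l: "(r \<cdot> g) \<cdot> f = ide D A" using assms r comp_assoc[of A B A A f g r] by simp
  have r: "f \<cdot> (g \<cdot> s) = ide D B" using assms s comp_assoc[of B B A B s g f] by simp
  have "r \<cdot> g = (r \<cdot> g) \<cdot> (f \<cdot> (g \<cdot> s))"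
    using r rg assms comp_ide_right[of B A "r \<cdot> g"] by simp
  also have "\<dots> = ((r \<cdot> g) \<cdot> f) \<cdot> (g \<cdot> s)"
    using rg assms comp_assoc[of B A B A "g \<cdot> s" f "r \<cdot> g"] by simp
  also have "\<dots> = g \<cdot> s" using l rg assms comp_ide_left[of B A "g \<cdot> s"] by simp
  finally show ?thesis unfolding isomorphism_def using assms(3) rg l r by auto
qed

text \<open>The extension is transported along the outer isomorphisms. Any realization of the result
  turns out to be equivalent to the primed sequence, which therefore realizes it too.\<close>

lemma conflation_iso:
  assumes c: "(A, B, X, x, y) \<in> conflations D"
    and O: "A' \<in> Obj D" "B' \<in> Obj D" "X' \<in> Obj D" and x': "x' \<in> mor D A' B'" and y': "y' \<in> mor D B' X'"
    and iso: "isomorphism D A A' a" "isomorphism D B B' b" "isomorphism D X X' z"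
    and comm: "b \<cdot> x = x' \<cdot> a" "z \<cdot> y = y' \<cdot> b"
  shows "(A', B', X', x', y') \<in> conflations D"
proof -
  note cc = conflationD[OF c]
  obtain \<delta> where \<delta>: "\<delta> \<in> carrier (Ext D X A)" "(B, x, y) \<in> realiz D X A \<delta>"
    using c by (rule conflationE)
  obtain a' where a: "a \<in> mor D A A'" "a' \<in> mor D A' A" "a' \<cdot> a = ide D A" "a \<cdot> a' = ide D A'"
    using iso(1) by (rule isomorphism_inverse)
  obtain b' where b: "isomorphism D B' B b'" "b \<in> mor D B B'" "b' \<in> mor D B' B"
      "b' \<cdot> b = ide D B" "b \<cdot> b' = ide D B'"
    using iso(2) by (rule isomorphism_inverse)
  obtain z' where z: "z \<in> mor D X X'" "z' \<in> mor D X' X" "z' \<cdot> z = ide D X" "z \<cdot> z' = ide D X'"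
    using iso(3) by (rule isomorphism_inverse)
  \<comment> \<open>With this choice \<open>a\<close> and \<open>z\<close>, as well as their
    inverses, form morphisms of extensions, so there are comparison maps \<open>s\<close> and
    \<open>t\<close> in both directions.\<close>
  define \<epsilon> where "\<epsilon> = push D a (pull D z' \<delta>)"
  have p: "pull D z' \<delta> \<in> carrier (Ext D X' A)" using pull_in \<delta> z cc O by blast
  then have \<epsilon>: "\<epsilon> \<in> carrier (Ext D X' A')" unfolding \<epsilon>_def using push_in cc O a by blast
  obtain P u v where P: "(P, u, v) \<in> realiz D X' A' \<epsilon>"
    using realiz_nonempty[OF O(3,1) \<epsilon>] by blast
  note PO = realizD[OF O(3,1) \<epsilon> P]
  have "pull D z \<epsilon> = push D a (pull D z (pull D z' \<delta>))"
    unfolding \<epsilon>_def using pb_pf[of X' X A A' z a "pull D z' \<delta>"] cc O z a p by simp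
  also have "pull D z (pull D z' \<delta>) = \<delta>"
    using pb_comp[of X X' X A z' z \<delta>] pb_ide z cc O \<delta> by simp
  finally have e1: "push D a \<delta> = pull D z \<epsilon>" ..
  have e2: "push D a' \<epsilon> = pull D z' \<delta>"
    unfolding \<epsilon>_def using pf_comp[of X' A A' A a a' "pull D z' \<delta>"] pf_ide a p cc O by simp
  obtain s where s: "s \<in> mor D B P" "s \<cdot> x = u \<cdot> a" "v \<cdot> s = z \<cdot> y"
    using realiz_morphism[OF cc(3,1) O(3,1) \<delta>(1) \<epsilon> \<delta>(2) P a(1) z(1) e1] by blast
  obtain t where t: "t \<in> mor D P B" "t \<cdot> u = x \<cdot> a'" "y \<cdot> t = z' \<cdot> v"
    using realiz_morphism[OF O(3,1) cc(3,1) \<epsilon> \<delta>(1) P \<delta>(2) a(2) z(2) e2] by blast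
  have Pc: "(A', P, X', u, v) \<in> conflations D" using conflationI O \<epsilon> P by blast
  \<comment> \<open>Both round trips respect the two morphisms of their conflation, so
    \<open>five_lemma_endo\<close> will make them isomorphisms.\<close>
  have "(t \<cdot> s) \<cdot> x = (x \<cdot> a') \<cdot> a"
    using comp_assoc[of A B P B x s t] comp_assoc[of A A' P B a u t] cc PO s t a O by simp
  also have "\<dots> = x" using comp_assoc[of A A' A B a a' x] comp_ide_right[of A B x] cc a O by simp
  finally have 1: "(t \<cdot> s) \<cdot> x = x" .
  have "y \<cdot> (t \<cdot> s) = z' \<cdot> (z \<cdot> y)"
    using comp_assoc[of B P B X s t y] comp_assoc[of B P X' X s v z'] cc PO s t z O by simp
  also have "\<dots> = y" using comp_assoc[of B X X' X y z z'] comp_ide_left[of B X y] cc z O by simp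
  finally have 2: "y \<cdot> (t \<cdot> s) = y" .
  have "(s \<cdot> t) \<cdot> u = (u \<cdot> a) \<cdot> a'"
    using comp_assoc[of A' P B P u t s] comp_assoc[of A' A B P a' x s] cc PO s t a O by simp
  also have "\<dots> = u" using comp_assoc[of A' A A' P a' a u] comp_ide_right[of A' P u] PO a O cc by simp
  finally have 3: "(s \<cdot> t) \<cdot> u = u" .
  have "v \<cdot> (s \<cdot> t) = z \<cdot> (z' \<cdot> v)"
    using comp_assoc[of P B P X' t s v] comp_assoc[of P B X X' t y z] cc PO s t z O by simp
  also have "\<dots> = v" using comp_assoc[of P X' X X' v z' z] comp_ide_left[of P X' v] PO z O cc by simp
  finally have 4: "v \<cdot> (s \<cdot> t) = v" .
  have "isomorphism D B P s"
    using isomorphism_if_left_right_inverse[of B P s t] five_lemma_endo[OF c _ 1 2]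
      five_lemma_endo[OF Pc _ 3 4] cc PO s t comp_in[of B P B] comp_in[of P B P] by blast
  then have sb: "isomorphism D B' P (s \<cdot> b')"
    using isomorphism_comp[of B' B P b' s] b O cc PO by blast
  have "b' \<cdot> x' = x \<cdot> a'"
  proof -
    have "x' = b \<cdot> (x \<cdot> a')"
      using comp_assoc[of A' A B B' a' x b] comp_assoc[of A' A A' B' a' a x'] comp_ide_right[of A' B' x']
        comm a x' O cc b by simp
    then show ?thesis
      using comp_assoc[of A' B B' B "x \<cdot> a'" b b'] comp_ide_left[of A' B "x \<cdot> a'"]
        comp_in[of A' A B a' x] b O cc a by simp
  qed
  then have 5: "(s \<cdot> b') \<cdot> x' = u"
    using comp_assoc[of A' B' B P x' b' s] comp_assoc[of A' A B P a' x s] comp_assoc[of A' A A' P a' a u]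
      comp_ide_right[of A' P u] s b x' O cc a PO by simp
  have 6: "v \<cdot> (s \<cdot> b') = y'"
    using comp_assoc[of B' B P X' b' s v] comp_assoc[of B' B B' X' b' b y'] comp_ide_right[of B' X' y']
      s b y' O cc PO comm by simp
  have "((B', x', y'), (P, u, v)) \<in> seq_equiv D A' X'"
    unfolding seq_equiv_def seqs_def using 5 6 sb O x' y' PO by auto
  then have "(B', x', y') \<in> realiz D X' A' \<epsilon>"
    using realiz_equiv[OF O(3,1) \<epsilon> P] seq_equiv_sym[OF O(1,3)] by blast
  then show ?thesis using conflationI O \<epsilon> by blast
qed

section \<open>Cancellation, composition and pushout\<close>

lemma inflation_left_cancel:
  assumes c: "(A, B, X, x, y) \<in> conflations D" and W: "W \<in> Obj D"
    and N: "carrier (NExt D W X) = {\<one>\<^bsub>NExt D W X\<^esub>}"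
    and g: "g \<in> mor D W A" "h \<in> mor D W A" "x \<cdot> g = x \<cdot> h"
  shows "g = h"
proof -
  note cc = conflationD[OF c]
  obtain \<delta> where \<delta>: "\<delta> \<in> carrier (Ext D X A)" "(B, x, y) \<in> realiz D X A \<delta>"
    using c by (rule conflationE)
  have "conn_contra D X A \<delta> W \<one>\<^bsub>NExt D W X\<^esub> = zero_mor D W A"
    using hom_one[OF conn_contra_hom[OF cc(3,1) W \<delta>(1)]] neg.val_comm_group hom_group W cc
    by (simp add: comm_group.axioms(2))
  \<comment> \<open>Exactness identifies the morphisms \<open>W\<close> -> \<open>A\<close> killed
    by \<open>x\<close> with the image of E^-1(W,X), which is trivial here.\<close>
  then have *: "kernel (Hom D W A) (Hom D W B) (\<lambda>f. x \<cdot> f) = {zero_mor D W A}"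
    using exact_contra[OF cc(3,1) W \<delta>] N by simp
  have "x \<cdot> sub W A g h = zero_mor D W B"
    using comp_sub_right[of W A B g h x] W cc g sub_eq_zero_iff[of W B] comp_in[of W A B] by simp
  then have "sub W A g h = zero_mor D W A"
    using * sub_in[of W A g h] W cc g unfolding kernel_def by blast
  then show ?thesis using sub_eq_zero_iff W cc g by blast
qed

lemma deflation_right_cancel:
  assumes "(A, B, X, x, y) \<in> conflations D" and "W \<in> Obj D"
    and "carrier (NExt D A W) = {\<one>\<^bsub>NExt D A W\<^esub>}"
    and "g \<in> mor D X W" "h \<in> mor D X W" "g \<cdot> y = h \<cdot> y"
  shows "g = h"
  using neg_extriangulated_category.inflation_left_cancel[OF dual, of X B A y x W g h] assms by simp

text \<open>ET4 with the extension classes forgotten. It serves both to compose inflations and to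
  factor a given deflation \<open>g'\<close> as \<open>e \<cdot> h\<close>.\<close>

lemma inflations_comp:
  assumes c1: "(A, B, X, f, f') \<in> conflations D" and c2: "(B, G, F, g, g') \<in> conflations D"
  obtains E d e h where "(A, G, E, g \<cdot> f, h) \<in> conflations D" "(X, E, F, d, e) \<in> conflations D"
    "e \<cdot> h = g'"
proof -
  note cc = conflationD[OF c1] conflationD[OF c2]
  obtain \<delta> where \<delta>: "\<delta> \<in> carrier (Ext D X A)" "(B, f, f') \<in> realiz D X A \<delta>"
    using c1 by (rule conflationE)
  obtain \<delta>' where \<delta>': "\<delta>' \<in> carrier (Ext D F B)" "(G, g, g') \<in> realiz D F B \<delta>'"
    using c2 by (rule conflationE)
  obtain E d e h' \<delta>'' where E: "E \<in> Obj D" "e \<cdot> h' = g'" "\<delta>'' \<in> carrier (Ext D E A)"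
      "(G, g \<cdot> f, h') \<in> realiz D E A \<delta>''" "(E, d, e) \<in> realiz D F X (push D f' \<delta>')"
    using ET4[OF cc(1-3) cc(8) \<delta>(1) \<delta>'(1) \<delta>(2) \<delta>'(2)] by blast
  have "(A, G, E, g \<cdot> f, h') \<in> conflations D" using conflationI E cc by blast
  moreover have "(X, E, F, d, e) \<in> conflations D"
    using conflationI[OF cc(8) cc(3) push_in E(5)] cc \<delta>' by blast
  ultimately show ?thesis using that E by blast
qed

text \<open>The realization of \<open>push D a \<delta>\<close> supplies \<open>P\<close>. In
  general the square is only a weak pushout: the last clause provides a mediating morphism without
  uniqueness.\<close>

lemma conflation_pushout:
  assumes c: "(A, B, X, x, y) \<in> conflations D" and A': "A' \<in> Obj D" and a: "a \<in> mor D A A'"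
  obtains P x' y' b where "(A', P, X, x', y') \<in> conflations D" "b \<in> mor D B P"
    "b \<cdot> x = x' \<cdot> a" "y' \<cdot> b = y"
    "\<And>W g h. \<lbrakk>W \<in> Obj D; g \<in> mor D A' W; h \<in> mor D B W; h \<cdot> x = g \<cdot> a\<rbrakk>
      \<Longrightarrow> \<exists>u\<in>mor D P W. u \<cdot> x' = g \<and> u \<cdot> b = h"
proof -
  note cc = conflationD[OF c]
  obtain \<delta> where \<delta>: "\<delta> \<in> carrier (Ext D X A)" "(B, x, y) \<in> realiz D X A \<delta>"
    using c by (rule conflationE)
  have \<epsilon>: "push D a \<delta> \<in> carrier (Ext D X A')" using push_in cc A' a \<delta> by blast
  obtain P x' y' where P: "(P, x', y') \<in> realiz D X A' (push D a \<delta>)"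
    using realiz_nonempty[OF cc(3) A' \<epsilon>] by blast
  note PO = realizD[OF cc(3) A' \<epsilon> P]
  have Pc: "(A', P, X, x', y') \<in> conflations D" using conflationI cc(3) A' \<epsilon> P by blast
  obtain b where b: "b \<in> mor D B P" "b \<cdot> x = x' \<cdot> a" "y' \<cdot> b = ide D X \<cdot> y"
    using realiz_morphism[OF cc(3,1) cc(3) A' \<delta>(1) \<epsilon> \<delta>(2) P a ide_in[OF cc(3)]]
      pb_ide[OF cc(3) A' \<epsilon>] by auto
  have by': "y' \<cdot> b = y" using b(3) cc comp_ide_left[of B X y] by simp
  show ?thesis
  proof (rule that[OF Pc b(1,2) by'])
    fix W g h assume W: "W \<in> Obj D" and g: "g \<in> mor D A' W" and h: "h \<in> mor D B W" and eq: "h \<cdot> x = g \<cdot> a"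
    \<comment> \<open>The obstruction to extending \<open>g\<close> along \<open>x'\<close> is the
      class pushed along \<open>g\<close>; it vanishes because \<open>g \<cdot> a\<close> factors
      through \<open>x\<close>, which annihilates \<open>\<delta>\<close>.\<close>
    have "push D g (push D a \<delta>) = push D h (push D x \<delta>)"
      using pf_comp[of X A A' W a g \<delta>] pf_comp[of X A B W x h \<delta>] eq W cc A' \<delta> a g h by simp
    also have "\<dots> = \<one>\<^bsub>Ext D X W\<^esub>"
      using push_inflation_zero[OF cc(3,1) \<delta>] hom_one[OF pf_hom[OF cc(3,2) W h]] val_comm_group cc W
      by (simp add: comm_group.axioms(2))
    finally have z: "push D g (push D a \<delta>) = pull D (ide D X) \<one>\<^bsub>Ext D X W\<^esub>"
      using pb_ide Ext_zero_in cc W by simp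
    \<comment> \<open>The vanishing class yields a morphism into the split conflation on W and X;
      projecting it to W gives a first candidate \<open>u\<close>.\<close>
    obtain S i j p q where S: "biproduct D W X S i j p q" using has_biproducts[OF W cc(3)] by blast
    note S' = S[unfolded biproduct_def]
    obtain t where t: "t \<in> mor D P S" "t \<cdot> x' = i \<cdot> g"
      using realiz_morphism[OF cc(3) A' cc(3) W \<epsilon> Ext_zero_in[OF cc(3) W] P
          realiz_zero[OF cc(3) W S] g ide_in[OF cc(3)] z] by blast
    define u where "u = p \<cdot> t"
    have u: "u \<in> mor D P W" unfolding u_def using comp_in[of P S W] PO S' W t by simp
    have ux: "u \<cdot> x' = g"
      unfolding u_def using comp_assoc[of A' P S W x' t p] comp_assoc[of A' W S W g i p]
        comp_ide_left[of A' W g] PO S' W t A' g by simp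
    have ub: "u \<cdot> b \<in> mor D B W" using comp_in[of B P W] PO W cc b u by simp
    \<comment> \<open>The candidate is right on \<open>x'\<close> but perhaps not on
      \<open>b\<close>. The error \<open>h - u \<cdot> b\<close> kills \<open>x\<close>, so it is
      some \<open>v \<cdot> y\<close>; adding \<open>v \<cdot> y'\<close> repairs the second
      condition and leaves the first intact, since \<open>y' \<cdot> x' = 0\<close>.\<close>
    have "(u \<cdot> b) \<cdot> x = g \<cdot> a"
      using comp_assoc[of A B P W x b u] comp_assoc[of A A' P W a x' u] cc PO W b u A' a ux by simp
    then have "sub B W h (u \<cdot> b) \<cdot> x = zero_mor D A W"
      using comp_sub_left[of A B W x h "u \<cdot> b"] sub_eq_zero_iff[of A W] comp_in[of A B W x h] eq cc W h ub
      by simp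
    then obtain v where v: "v \<in> mor D X W" "v \<cdot> y = sub B W h (u \<cdot> b)"
      using weak_cokernel[OF c W sub_in[OF cc(2) W h ub]] by blast
    define w where "w = v \<cdot> y'"
    have w: "w \<in> mor D P W" unfolding w_def using comp_in[of P X W] PO W cc v by simp
    have "w \<cdot> x' = zero_mor D A' W"
      unfolding w_def using comp_assoc[of A' P X W x' y' v] conflation_comp[OF Pc]
        comp_zero_right[of A' X W v] PO W cc v A' by simp
    then have "(u \<otimes>\<^bsub>Hom D P W\<^esub> w) \<cdot> x' = g"
      using comp_add_left[of A' P W x' u w] PO A' W u w ux add_zero g by simp
    moreover have "w \<cdot> b = sub B W h (u \<cdot> b)"
      unfolding w_def using comp_assoc[of B P X W b y' v] by' PO W cc v b by simp
    then have "(u \<otimes>\<^bsub>Hom D P W\<^esub> w) \<cdot> b = h"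
      using comp_add_left[of B P W b u w] PO cc b W u w add_sub[of B W h "u \<cdot> b"] h ub by simp
    moreover have "u \<otimes>\<^bsub>Hom D P W\<^esub> w \<in> mor D P W" using add_in PO W u w by blast
    ultimately show "\<exists>u\<in>mor D P W. u \<cdot> x' = g \<and> u \<cdot> b = h" by blast
  qed
qed

end


section \<open>Full subcategories\<close>

lemma full_subcategory_simps [simp]:
  "Obj (full_subcategory C U) = U"
  "Hom (full_subcategory C U) = Hom C"
  "ide (full_subcategory C U) = ide C"
  "g \<cdot>\<^bsub>full_subcategory C U\<^esub> f = g \<cdot>\<^bsub>C\<^esub> f"
  "isomorphism (full_subcategory C U) A B f = isomorphism C A B f"
  by (simp_all add: full_subcategory_def isomorphism_def)

lemma inflation_opposite [simp]:
  "inflation (conflations_within (opposite D) U) A B i = deflation (conflations_within D U) B A i"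
  "deflation (conflations_within (opposite D) U) A B i = inflation (conflations_within D U) B A i"
  by (simp_all add: inflation_def deflation_def)

lemma (in preadditive_category) preadditive_full_subcategory:
  assumes "U \<subseteq> Obj C"
  shows "preadditive_category (full_subcategory C U)"
proof -
  have U: "X \<in> U \<Longrightarrow> X \<in> Obj C" for X using assms by blast
  show ?thesis
    by (intro preadditive_category.intro)
      (simp_all add: U hom_comm_group ide_in comp_add_left comp_add_right,
        (blast intro: U comp_in comp_ide_left comp_ide_right comp_assoc)+)
qed

lemma (in additive_category) additive_full_subcategory:
  assumes "U \<subseteq> Obj C" and "\<And>Z. zero_object C Z \<Longrightarrow> Z \<in> U"
    and "\<And>A B S i j p q. \<lbrakk>A \<in> U; B \<in> U; biproduct C A B S i j p q\<rbrakk> \<Longrightarrow> S \<in> U"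
  shows "additive_category (full_subcategory C U)"
proof (intro additive_category.intro preadditive_full_subcategory additive_category_axioms.intro)
  show "U \<subseteq> Obj C" by fact
  obtain Z where Z: "zero_object C Z" using has_zero_object by blast
  have "X \<in> Obj C" if "X \<in> U" for X using that assms(1) by blast
  then have "zero_object (full_subcategory C U) Z"
    using Z assms(2)[OF Z] by (simp add: zero_object_def)
  then show "\<exists>Z. zero_object (full_subcategory C U) Z" ..
next
  fix A B assume AB: "A \<in> Obj (full_subcategory C U)" "B \<in> Obj (full_subcategory C U)"
  then have "A \<in> Obj C" "B \<in> Obj C" using assms(1) by auto
  then obtain S i j p q where S: "biproduct C A B S i j p q" using has_biproducts[of A B] by blast
  then have "S \<in> U" using AB assms(3)[of A B S i j p q] by simp
  then have "biproduct (full_subcategory C U) A B S i j p q"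
    using S by (simp add: biproduct_def)
  then show "\<exists>S i j p q. biproduct (full_subcategory C U) A B S i j p q" by blast
qed

section \<open>Cancellation of kernels and cokernels, independence of the choice of coimage\<close>

context preadditive_category
begin

lemma cokernel_right_cancel:
  assumes O: "X \<in> Obj C" "Y \<in> Obj C" "W \<in> Obj C" and f: "f \<in> mor C X Y" and c: "is_cokernel C X Y f Q q"
    and g: "g \<in> mor C Q W" "h \<in> mor C Q W" "g \<cdot> q = h \<cdot> q"
  shows "g = h"
proof -
  have q: "Q \<in> Obj C" "q \<in> mor C Y Q" "q \<cdot> f = zero_mor C X Q" using c by (simp_all add: is_cokernel_def)
  have "(g \<cdot> q) \<cdot> f = zero_mor C X W"
    using comp_assoc[of X Y Q W f q g] comp_zero_right[of X Q W g] O f q g by simp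
  moreover have "g \<cdot> q \<in> mor C Y W" using comp_in[of Y Q W] O q g by simp
  ultimately have "\<exists>!u. u \<in> mor C Q W \<and> u \<cdot> q = g \<cdot> q"
    using c O(3) unfolding is_cokernel_def by blast
  then show ?thesis using g by metis
qed

lemma kernel_left_cancel:
  assumes O: "X \<in> Obj C" "Y \<in> Obj C" "W \<in> Obj C" and f: "f \<in> mor C X Y" and c: "is_kernel C X Y f K k"
    and g: "g \<in> mor C W K" "h \<in> mor C W K" "k \<cdot> g = k \<cdot> h"
  shows "g = h"
proof -
  have k: "K \<in> Obj C" "k \<in> mor C K X" "f \<cdot> k = zero_mor C K Y" using c by (simp_all add: is_kernel_def)
  have "f \<cdot> (k \<cdot> g) = zero_mor C W Y"
    using comp_assoc[of W K X Y g k f] comp_zero_left[of W K Y g] O f k g by simp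
  moreover have "k \<cdot> g \<in> mor C W X" using comp_in[of W K X] O k g by simp
  ultimately have "\<exists>!u. u \<in> mor C W K \<and> k \<cdot> u = k \<cdot> g"
    using c O(3) unfolding is_kernel_def by blast
  then show ?thesis using g by metis
qed

text \<open>A kernel of \<open>f\<close> and a cokernel of that kernel are unique up to isomorphism, so that the
  monicity of \<open>e\<close> carries over from one choice \<open>f = e \<cdot> h\<close> to every other.\<close>

lemma coimage_mono:
  assumes O: "X \<in> Obj C" "Y \<in> Obj C" and f: "f \<in> mor C X Y"
    and K: "is_kernel C X Y f K k" and Q: "is_cokernel C K X k Q q"
    and L: "is_kernel C X Y f L l" and E: "is_cokernel C L X l E h"
    and e: "monomorphism C E Y e" "e \<cdot> h = f"
  shows "\<exists>v. monomorphism C Q Y v \<and> v \<cdot> q = f"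
proof -
  have k: "K \<in> Obj C" "k \<in> mor C K X" "f \<cdot> k = zero_mor C K Y" using K by (simp_all add: is_kernel_def)
  have l: "L \<in> Obj C" "l \<in> mor C L X" "f \<cdot> l = zero_mor C L Y" using L by (simp_all add: is_kernel_def)
  have q: "Q \<in> Obj C" "q \<in> mor C X Q" "q \<cdot> k = zero_mor C K Q" using Q by (simp_all add: is_cokernel_def)
  have h: "E \<in> Obj C" "h \<in> mor C X E" "h \<cdot> l = zero_mor C L E" using E by (simp_all add: is_cokernel_def)
  have eY: "e \<in> mor C E Y" using e(1) by (simp add: monomorphism_def)
  obtain a where a: "a \<in> mor C K L" "l \<cdot> a = k" using L k unfolding is_kernel_def by metis
  obtain b where b: "b \<in> mor C L K" "k \<cdot> b = l" using K l unfolding is_kernel_def by metis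
  have "h \<cdot> k = zero_mor C K E"
    using comp_assoc[of K L X E a l h] comp_zero_left[of K L E a] O k l h a by simp
  then obtain r where r: "r \<in> mor C Q E" "r \<cdot> q = h" using Q h unfolding is_cokernel_def by metis
  have "q \<cdot> l = zero_mor C L Q"
    using comp_assoc[of L K X Q b k q] comp_zero_left[of L K Q b] O k l q b by simp
  then obtain s where s: "s \<in> mor C E Q" "s \<cdot> h = q" using E q unfolding is_cokernel_def by metis
  \<comment> \<open>A left inverse of \<open>r\<close> makes \<open>r\<close> left cancellable, and
    with it the composite \<open>e \<cdot> r\<close>.\<close>
  have "(s \<cdot> r) \<cdot> q = ide C Q \<cdot> q"
    using comp_assoc[of X Q E Q q r s] comp_ide_left[of X Q q] O q h r s by simp
  then have sr: "s \<cdot> r = ide C Q"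
    using cokernel_right_cancel[OF k(1) O(1) q(1) k(2) Q] comp_in[of Q E Q] ide_in q h r s by simp
  define v where "v = e \<cdot> r"
  have v: "v \<in> mor C Q Y" unfolding v_def using comp_in[of Q E Y] O q h r eY by simp
  have "monomorphism C Q Y v"
    unfolding monomorphism_def
  proof (intro conjI ballI impI v)
    fix W g g' assume W: "W \<in> Obj C" and g: "g \<in> mor C W Q" "g' \<in> mor C W Q" "v \<cdot> g = v \<cdot> g'"
    have "e \<cdot> (r \<cdot> g) = e \<cdot> (r \<cdot> g')"
      using g(3) comp_assoc[of W Q E Y g r e] comp_assoc[of W Q E Y g' r e] W O q h r eY g
      unfolding v_def by simp
    moreover have "r \<cdot> g \<in> mor C W E" "r \<cdot> g' \<in> mor C W E"
      using comp_in[of W Q E] W q h r g by blast+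
    ultimately have "r \<cdot> g = r \<cdot> g'" using e(1) W unfolding monomorphism_def by blast
    then have "(s \<cdot> r) \<cdot> g = (s \<cdot> r) \<cdot> g'"
      using comp_assoc[of W Q E Q g r s] comp_assoc[of W Q E Q g' r s] W q h r s g by simp
    then show "g = g'" using sr comp_ide_left[of W Q g] comp_ide_left[of W Q g'] W q g by simp
  qed
  moreover have "v \<cdot> q = f"
    unfolding v_def using comp_assoc[of X Q E Y q r e] O q h r eY e(2) by simp
  ultimately show ?thesis by blast
qed

end

section \<open>Torsion pairs\<close>

lemma vanishesD: "\<lbrakk>vanishes G S T; A \<in> S; B \<in> T\<rbrakk> \<Longrightarrow> carrier (G A B) = {\<one>\<^bsub>G A B\<^esub>}"
  by (auto simp: vanishes_def)

lemma stors_opposite: "(T, F) \<in> stors D \<Longrightarrow> (F, T) \<in> stors (opposite D)"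
  unfolding stors_def by simp blast

context neg_extriangulated_category
begin

text \<open>If \<open>X\<close> has no morphisms to \<open>F\<close>, then in its torsion conflation
  A -> X -> B the deflation vanishes, so the inflation has a right inverse. As E^-1(A,B) = 0 it is
  also left cancellable, hence an isomorphism, and \<open>T\<close> is closed under
  isomorphisms.\<close>

lemma torsion_iff:
  assumes t: "(T, F) \<in> stors D"
  shows "X \<in> T \<longleftrightarrow> X \<in> Obj D \<and> (\<forall>Y\<in>F. mor D X Y = {zero_mor D X Y})"
proof
  assume "X \<in> T"
  then show "X \<in> Obj D \<and> (\<forall>Y\<in>F. mor D X Y = {zero_mor D X Y})"
    using t vanishesD[of "Hom D" T F X] by (auto simp: stors_def replete_def)
next
  assume X: "X \<in> Obj D \<and> (\<forall>Y\<in>F. mor D X Y = {zero_mor D X Y})"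
  obtain A B x y where A: "A \<in> T" "B \<in> F" and c: "(A, X, B, x, y) \<in> conflations D"
    using t X unfolding stors_def by blast
  note cc = conflationD[OF c]
  have N: "carrier (NExt D A B) = {\<one>\<^bsub>NExt D A B\<^esub>}"
    using t A vanishesD[of "NExt D" T F A B] by (simp add: stors_def)
  have "y = zero_mor D X B" using X A cc(5) by blast
  then have "y \<cdot> ide D X = zero_mor D X B" using comp_ide_right[OF cc(2,3,5)] by simp
  then obtain s where s: "s \<in> mor D X A" "x \<cdot> s = ide D X"
    using weak_kernel[OF c cc(2) ide_in[OF cc(2)]] by blast
  have "ide D B \<cdot> y = zero_mor D B B \<cdot> y"
    using comp_ide_left[OF cc(2,3,5)] comp_zero_left[OF cc(2,3,3,5)] \<open>y = zero_mor D X B\<close> by simp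
  then have "ide D B = zero_mor D B B"
    using deflation_right_cancel[OF c cc(3) N] ide_in[OF cc(3)] zero_in[OF cc(3,3)] by blast
  have "A \<in> Obj D" "s \<cdot> x \<in> mor D A A" using cc s comp_in[of A X A x s] by blast+
  moreover have "x \<cdot> (s \<cdot> x) = x \<cdot> ide D A"
    using comp_assoc[of A X A X x s x] comp_ide_left[of A X x] comp_ide_right[of A X x] cc s by simp
  ultimately have "s \<cdot> x = ide D A"
    using inflation_left_cancel[OF c cc(1) N] ide_in by blast
  then have "isomorphism D A X x" unfolding isomorphism_def using cc s by blast
  then show "X \<in> T" using t A X unfolding stors_def replete_def by blast
qed

lemma torsionfree_iff:
  assumes "(T, F) \<in> stors D"
  shows "X \<in> F \<longleftrightarrow> X \<in> Obj D \<and> (\<forall>Y\<in>T. mor D Y X = {zero_mor D Y X})"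
  using neg_extriangulated_category.torsion_iff[OF dual stors_opposite[OF assms]] by simp

text \<open>By orthogonality it suffices to test morphisms from \<open>B\<close> to
  \<open>F\<close>: these vanish on \<open>A\<close>, so they factor through \<open>X\<close>, where
  they vanish too.\<close>

lemma torsion_extension_closed:
  assumes t: "(T, F) \<in> stors D" and c: "(A, B, X, x, y) \<in> conflations D" and "A \<in> T" "X \<in> T"
  shows "B \<in> T"
  unfolding torsion_iff[OF t]
proof (intro conjI ballI)
  note cc = conflationD[OF c]
  show "B \<in> Obj D" by fact
  fix Y assume Y: "Y \<in> F"
  then have YO: "Y \<in> Obj D" using torsionfree_iff[OF t] by blast
  have A: "mor D A Y = {zero_mor D A Y}" "mor D X Y = {zero_mor D X Y}"
    using assms(3,4) Y torsion_iff[OF t] by blast+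
  have "f = zero_mor D B Y" if f: "f \<in> mor D B Y" for f
  proof -
    have "f \<cdot> x = zero_mor D A Y" using comp_in[OF cc(1,2) YO cc(4) f] A by blast
    then obtain g where "g \<in> mor D X Y" "g \<cdot> y = f" using weak_cokernel[OF c YO f] by blast
    then show ?thesis using A comp_zero_left[OF cc(2,3) YO cc(5)] by simp
  qed
  then show "mor D B Y = {zero_mor D B Y}" using zero_in[OF cc(2) YO] by blast
qed

lemma torsionfree_extension_closed:
  assumes "(T, F) \<in> stors D" "(A, B, X, x, y) \<in> conflations D" "A \<in> F" "X \<in> F"
  shows "B \<in> F"
  using neg_extriangulated_category.torsion_extension_closed[OF dual stors_opposite[OF assms(1)]] assms
  by simp

lemma zero_object_torsion:
  assumes "(T, F) \<in> stors D" "zero_object D Z"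
  shows "Z \<in> T"
  unfolding torsion_iff[OF assms(1)]
  using zero_object_mor(2)[OF assms(2)] torsionfree_iff[OF assms(1)] assms(2)
  by (simp add: zero_object_def)

lemma zero_object_torsionfree:
  assumes "(T, F) \<in> stors D" "zero_object D Z"
  shows "Z \<in> F"
  using neg_extriangulated_category.zero_object_torsion[OF dual stors_opposite[OF assms(1)]] assms
  by simp

text \<open>A biproduct is a split extension of its summands, so extension closure keeps biproducts
  inside the heart.\<close>

lemma conflation_biproduct:
  assumes "A \<in> Obj D" "X \<in> Obj D" "biproduct D A X B i j p q"
  shows "(A, B, X, i, q) \<in> conflations D"
  using conflationI[OF assms(2,1) Ext_zero_in realiz_zero[OF assms(2,1,3)]] assms by blast

end

section \<open>The heart of a normal interval\<close>

text \<open>The two pairs are given as four separate classes, so that dualizing becomes a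
  permutation of parameters.\<close>

locale abelian_like_heart = neg_extriangulated_category D
  for D :: "('o, 'm, 'e, 'n, 'z) neg_extri_scheme" (structure) +
  fixes T1 F1 T2 F2 :: "'o set"
  assumes normal: "normal_interval D (T1, F1) (T2, F2)"
    and heart_conflations: "\<lbrakk>X \<in> F1 \<inter> T2; Y \<in> F1 \<inter> T2; f \<in> mor D X Y\<rbrakk> \<Longrightarrow>
      (\<exists>Z c. (X, Y, Z, f, c) \<in> conflations D) \<and> (\<exists>K k. (K, X, Y, k, f) \<in> conflations D)"
begin

abbreviation H :: "'o set" where "H \<equiv> F1 \<inter> T2"
abbreviation \<H> :: "('o, 'm, 'e, 'n, 'z) neg_extri_scheme" where "\<H> \<equiv> full_subcategory D H"

lemma t1: "(T1, F1) \<in> stors D" and t2: "(T2, F2) \<in> stors D" and T1_sub_T2: "T1 \<subseteq> T2"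
  and NExt_T2_F1: "\<lbrakk>A \<in> T2; B \<in> F1\<rbrakk> \<Longrightarrow> carrier (NExt D A B) = {\<one>\<^bsub>NExt D A B\<^esub>}"
  using normal vanishesD[of "NExt D" T2 F1 A B] by (simp_all add: normal_interval_def stors_le_def)

lemma F2_sub_F1: "F2 \<subseteq> F1"
  using torsionfree_iff[OF t1] torsionfree_iff[OF t2] T1_sub_T2 by blast

lemma T2_Obj: "X \<in> T2 \<Longrightarrow> X \<in> Obj D" and F1_Obj: "X \<in> F1 \<Longrightarrow> X \<in> Obj D"
  using torsion_iff[OF t2] torsionfree_iff[OF t1] by blast+

text \<open>Duality swaps torsion with torsion-free classes and the two ends of the interval. The
  dual heart is \<open>T2 \<inter> F1\<close>, which explains the recurring
  \<open>Int_commute\<close>.\<close>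

lemma heart_dual: "abelian_like_heart (opposite D) F2 T2 F1 T1"
proof (intro abelian_like_heart.intro dual abelian_like_heart_axioms.intro)
  have "vanishes (NExt D) T2 F1" using normal by (simp add: normal_interval_def)
  then show "normal_interval (opposite D) (F2, T2) (F1, T1)"
    using t1 t2 F2_sub_F1 stors_opposite by (auto simp: normal_interval_def stors_le_def)
qed (use heart_conflations in auto)

lemma heart_extension_closed:
  assumes "(A, B, X, x, y) \<in> conflations D" "A \<in> H" "X \<in> H"
  shows "B \<in> H"
  using torsion_extension_closed[OF t2 assms(1)] torsionfree_extension_closed[OF t1 assms(1)] assms
  by blast

lemma zero_object_heart: "zero_object D Z \<Longrightarrow> Z \<in> H"
  using zero_object_torsion[OF t2] zero_object_torsionfree[OF t1] by blast

lemma heart_additive: "additive_category \<H>"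
proof (rule additive_full_subcategory)
  show "H \<subseteq> Obj D" using T2_Obj by blast
  show "zero_object D Z \<Longrightarrow> Z \<in> H" for Z by (rule zero_object_heart)
  fix A B S i j p q assume "A \<in> H" "B \<in> H" "biproduct D A B S i j p q"
  then show "S \<in> H" using heart_extension_closed[OF conflation_biproduct] T2_Obj by blast
qed

section \<open>The exact structure on the heart\<close>

lemma kernel_within:
  assumes "(A, B, X, x, y) \<in> conflations_within D H"
  shows "is_kernel \<H> B X y A x"
proof -
  have c: "(A, B, X, x, y) \<in> conflations D" and "A \<in> H" "B \<in> H" "X \<in> H"
    using assms by (simp_all add: conflations_within_def)
  note cc = conflationD[OF c]
  have "\<exists>!h. h \<in> mor D W A \<and> x \<cdot> h = g" if W: "W \<in> H" and g: "g \<in> mor D W B" "y \<cdot> g = zero_mor D W X"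
    for W g
  proof -
    have WO: "W \<in> Obj D" using W T2_Obj by blast
    \<comment> \<open>Existence holds for every conflation; uniqueness follows from E^-1(W,X) = 0,
      because \<open>W\<close> lies in \<open>T2\<close> and \<open>X\<close> in
      \<open>F1\<close>.\<close>
    obtain h where "h \<in> mor D W A" "x \<cdot> h = g" using weak_kernel[OF c WO g] by blast
    then show ?thesis
      using inflation_left_cancel[OF c WO NExt_T2_F1] W \<open>X \<in> H\<close> by blast
  qed
  then show ?thesis
    using cc conflation_comp[OF c] \<open>A \<in> H\<close> by (simp add: is_kernel_def)
qed

lemma cokernel_within:
  assumes "(A, B, X, x, y) \<in> conflations_within D H"
  shows "is_cokernel \<H> A B x X y"
  using abelian_like_heart.kernel_within[OF heart_dual, of X B A y x] assms by (simp add: Int_commute)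

lemma inflation_ide_within: "A \<in> H \<Longrightarrow> inflation (conflations_within D H) A A (ide D A)"
  using has_zero_object conflation_ide[of _ A] zero_object_heart T2_Obj
  unfolding inflation_def conflations_within_def by blast

lemma deflation_ide_within: "A \<in> H \<Longrightarrow> deflation (conflations_within D H) A A (ide D A)"
  using abelian_like_heart.inflation_ide_within[OF heart_dual, of A] by (simp add: Int_commute)

text \<open>The end term of the composite conflation is an extension of \<open>B\<close> by
  \<open>A\<close>, so it stays in the heart.\<close>

lemma inflation_comp_within:
  assumes "inflation (conflations_within D H) X Y f" "inflation (conflations_within D H) Y Z g"
  shows "inflation (conflations_within D H) X Z (g \<cdot> f)"
proof -
  obtain A f' where c1: "(X, Y, A, f, f') \<in> conflations D" and X: "X \<in> H" "A \<in> H"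
    using assms(1) by (auto simp: inflation_def conflations_within_def)
  obtain B g' where c2: "(Y, Z, B, g, g') \<in> conflations D" and Z: "Z \<in> H" "B \<in> H"
    using assms(2) by (auto simp: inflation_def conflations_within_def)
  obtain E d e h where c: "(X, Z, E, g \<cdot> f, h) \<in> conflations D" "(A, E, B, d, e) \<in> conflations D"
    "e \<cdot> h = g'"
    by (rule inflations_comp[OF c1 c2])
  then have "E \<in> H" using heart_extension_closed X Z by blast
  then show ?thesis using c X Z unfolding inflation_def conflations_within_def by blast
qed

lemma deflation_comp_within:
  assumes "deflation (conflations_within D H) X Y f" "deflation (conflations_within D H) Y Z g"
  shows "deflation (conflations_within D H) X Z (g \<cdot> f)"
  using abelian_like_heart.inflation_comp_within[OF heart_dual, of Z Y g X f] assms
  by (simp add: Int_commute)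

text \<open>The object \<open>P\<close> is an extension of \<open>Z\<close> by \<open>A'\<close>,
  hence in the heart, and there the weak pushout becomes a true one.\<close>

lemma inflation_pushout_within:
  assumes i: "inflation (conflations_within D H) A B i" and A': "A' \<in> H" and f: "f \<in> mor D A A'"
  shows "\<exists>P i' f'. is_pushout \<H> A B A' i f P i' f' \<and> inflation (conflations_within D H) A' P i'"
proof -
  obtain Z p where w: "(A, B, Z, i, p) \<in> conflations_within D H" using i by (auto simp: inflation_def)
  then have c: "(A, B, Z, i, p) \<in> conflations D" and AH: "A \<in> H" "B \<in> H" "Z \<in> H"
    by (simp_all add: conflations_within_def)
  note cc = conflationD[OF c]
  have A'O: "A' \<in> Obj D" using A' T2_Obj by blast
  obtain P i' p' f' where P: "(A', P, Z, i', p') \<in> conflations D"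
      and f': "f' \<in> mor D B P" "f' \<cdot> i = i' \<cdot> f" "p' \<cdot> f' = p"
      and ex: "\<And>W g h. \<lbrakk>W \<in> Obj D; g \<in> mor D A' W; h \<in> mor D B W; h \<cdot> i = g \<cdot> f\<rbrakk>
        \<Longrightarrow> \<exists>u\<in>mor D P W. u \<cdot> i' = g \<and> u \<cdot> f' = h"
    using conflation_pushout[OF c A'O f] by (metis (no_types, lifting))
  note PO = conflationD[OF P]
  have PH: "P \<in> H" using heart_extension_closed[OF P A'] AH by blast
  have "u = v" if W: "W \<in> H" and u: "u \<in> mor D P W" "v \<in> mor D P W"
      and eq: "u \<cdot> i' = v \<cdot> i'" "u \<cdot> f' = v \<cdot> f'" for W u v
  proof -
    have WO: "W \<in> Obj D" using W T2_Obj by blast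
    \<comment> \<open>The difference kills \<open>i'\<close>, so it equals some
      \<open>t \<cdot> p'\<close>. It also kills \<open>f'\<close>, hence
      \<open>t \<cdot> p = 0\<close>, and \<open>p\<close> is right cancellable against
      \<open>W\<close> because E^-1(A,W) = 0.\<close>
    have "sub P W u v \<cdot> i' = zero_mor D A' W"
      using comp_sub_left[of A' P W i' u v] sub_eq_zero_iff[of A' W] comp_in[of A' P W i'] eq PO WO u by simp
    then obtain t where t: "t \<in> mor D Z W" "t \<cdot> p' = sub P W u v"
      using weak_cokernel[OF P WO sub_in[OF PO(2) WO u]] by blast
    have "t \<cdot> p = sub P W u v \<cdot> f'"
      using comp_assoc[of B P Z W f' p' t] cc PO WO t f' by simp
    also have "\<dots> = zero_mor D B W"
      using comp_sub_left[of B P W f' u v] sub_eq_zero_iff[of B W] comp_in[of B P W f'] eq cc PO WO u f' by simp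
    also have "\<dots> = zero_mor D Z W \<cdot> p" using comp_zero_left[OF cc(2,3) WO cc(5)] by simp
    finally have "t = zero_mor D Z W"
      using deflation_right_cancel[OF c WO NExt_T2_F1 t(1) zero_in[OF cc(3) WO]] AH W by blast
    then have "sub P W u v = zero_mor D P W" using t(2) comp_zero_left[OF PO(2,3) WO PO(5)] by simp
    then show ?thesis using sub_eq_zero_iff[OF PO(2) WO u] by blast
  qed
  then have "\<exists>!u. u \<in> mor D P W \<and> u \<cdot> i' = g \<and> u \<cdot> f' = h"
    if "W \<in> H" "g \<in> mor D A' W" "h \<in> mor D B W" "h \<cdot> i = g \<cdot> f" for W g h
    using ex[of W g h] T2_Obj[of W] that by (metis IntD2)
  then have "is_pushout \<H> A B A' i f P i' f'"
    unfolding is_pushout_def using PH PO f' by simp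
  moreover have "inflation (conflations_within D H) A' P i'"
    unfolding inflation_def conflations_within_def using P A' PH AH by blast
  ultimately show ?thesis by blast
qed

lemma deflation_pullback_within:
  assumes "deflation (conflations_within D H) B A p" "A' \<in> H" "f \<in> mor D A' A"
  shows "\<exists>P p' f'. is_pullback \<H> A B A' p f P p' f' \<and> deflation (conflations_within D H) P A' p'"
  using abelian_like_heart.inflation_pushout_within[OF heart_dual, of A B p A' f] assms
  by (simp add: Int_commute)

lemma heart_exact: "exact_category \<H> (conflations_within D H)"
proof (intro exact_category.intro heart_additive exact_category_axioms.intro, goal_cases)
  case (1 A B Z i p)
  then have "(A, B, Z, i, p) \<in> conflations D" "A \<in> H" "B \<in> H" "Z \<in> H"
    by (simp_all add: conflations_within_def)
  then show ?case using conflationD[of A B Z i p] kernel_within[OF 1] cokernel_within[OF 1] by simp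
next
  case (2 A B Z i p A' B' Z' i' p' a b z)
  then show ?case
    using conflation_iso[of A B Z i p A' B' Z' i' p' a b z] T2_Obj
    by (simp add: conflations_within_def)
next
  case 3 then show ?case using inflation_ide_within by simp
next
  case 4 then show ?case using deflation_ide_within by simp
next
  case 5 then show ?case using inflation_comp_within by simp
next
  case 6 then show ?case using deflation_comp_within by simp
next
  case 7 then show ?case using inflation_pushout_within by simp
next
  case 8 then show ?case using deflation_pullback_within by simp
qed

section \<open>Kernels, coimages and the semi-abelian property\<close>

lemma coimage_factorization:
  assumes X: "X \<in> H" and Y: "Y \<in> H" and f: "f \<in> mor D X Y"
  obtains K k E q e where "(K, X, E, k, q) \<in> conflations_within D H" "monomorphism \<H> E Y e" "e \<cdot> q = f"
proof -
  obtain L l where L: "(L, X, Y, l, f) \<in> conflations D" using heart_conflations[OF X Y f] by blast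
  note LO = conflationD[OF L]
  \<comment> \<open>The term \<open>L\<close> need not lie in the heart; its torsion part for the
    upper pair will be the kernel of \<open>f\<close>.\<close>
  obtain K F t p where K: "K \<in> T2" "F \<in> F2" and c: "(K, L, F, t, p) \<in> conflations D"
    using t2 LO(1) unfolding stors_def by blast
  obtain E d e q where E: "(K, X, E, l \<cdot> t, q) \<in> conflations D" "(F, E, Y, d, e) \<in> conflations D"
      and eq: "e \<cdot> q = f"
    by (rule inflations_comp[OF c L])
  note EO = conflationD[OF E(1)] and FO = conflationD[OF E(2)]
  have EF: "E \<in> F1" using torsionfree_extension_closed[OF t1 E(2)] F2_sub_F1 K Y by blast
  \<comment> \<open>A morphism from \<open>E\<close> to \<open>F2\<close> vanishes after composing
    with \<open>q\<close>, as \<open>X\<close> is in \<open>T2\<close>; and \<open>q\<close> can be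
    cancelled because E^-1(K,G) = 0.\<close>
  have "mor D E G = {zero_mor D E G}" if G: "G \<in> F2" for G
  proof -
    have GF: "G \<in> F1" and GO: "G \<in> Obj D" using G F2_sub_F1 F1_Obj by blast+
    have "g = zero_mor D E G" if g: "g \<in> mor D E G" for g
    proof -
      have "mor D X G = {zero_mor D X G}" using torsion_iff[OF t2] X G by blast
      then have "g \<cdot> q = zero_mor D E G \<cdot> q"
        using comp_in[OF EO(2,3) GO EO(5) g] comp_zero_left[OF EO(2,3) GO EO(5)] by simp
      then show ?thesis
        using deflation_right_cancel[OF E(1) GO NExt_T2_F1[OF K(1) GF] g zero_in[OF EO(3) GO]] by blast
    qed
    then show ?thesis using zero_in[OF EO(3) GO] by blast
  qed
  then have "E \<in> T2" using torsion_iff[OF t2] EO(3) by blast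
  then have EH: "E \<in> H" using EF by blast
  \<comment> \<open>Likewise a morphism from \<open>T1\<close> to \<open>K\<close> vanishes in
    \<open>X\<close>, which is in \<open>F1\<close>, and the inflation can be cancelled because
    E^-1(W,E) = 0.\<close>
  have "mor D W K = {zero_mor D W K}" if W: "W \<in> T1" for W
  proof -
    have WT: "W \<in> T2" and WO: "W \<in> Obj D" using W T1_sub_T2 T2_Obj by blast+
    have "g = zero_mor D W K" if g: "g \<in> mor D W K" for g
    proof -
      have "mor D W X = {zero_mor D W X}" using torsion_iff[OF t1] W X by blast
      then have "(l \<cdot> t) \<cdot> g = (l \<cdot> t) \<cdot> zero_mor D W K"
        using comp_in[OF WO EO(1,2) g EO(4)] comp_zero_right[OF WO EO(1,2,4)] by simp
      then show ?thesis
        using inflation_left_cancel[OF E(1) WO NExt_T2_F1[OF WT EF] g zero_in[OF WO EO(1)]] by blast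
    qed
    then show ?thesis using zero_in[OF WO EO(1)] by blast
  qed
  then have "K \<in> F1" using torsionfree_iff[OF t1] EO(1) by blast
  then have conf: "(K, X, E, l \<cdot> t, q) \<in> conflations_within D H"
    using E(1) K X EH by (simp add: conflations_within_def)
  have "g = h" if W: "W \<in> H" and g: "g \<in> mor D W E" "h \<in> mor D W E" "e \<cdot> g = e \<cdot> h" for W g h
  proof -
    have WO: "W \<in> Obj D" using W T2_Obj by blast
    \<comment> \<open>The difference factors through \<open>F\<close>, and there are no nonzero
      morphisms from \<open>T2\<close> to \<open>F2\<close>.\<close>
    have "e \<cdot> sub W E g h = zero_mor D W Y"
      using comp_sub_right[of W E Y g h e] sub_eq_zero_iff[of W Y] comp_in[of W E Y _ e] FO WO g by simp
    then obtain u where u: "u \<in> mor D W F" "d \<cdot> u = sub W E g h"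
      using weak_kernel[OF E(2) WO sub_in[OF WO FO(2) g(1,2)]] by blast
    have "u = zero_mor D W F" using u(1) torsion_iff[OF t2] W K by blast
    then have "sub W E g h = zero_mor D W E" using u(2) comp_zero_right[OF WO FO(1,2,4)] by simp
    then show ?thesis using sub_eq_zero_iff[OF WO FO(2) g(1,2)] by blast
  qed
  then have "monomorphism \<H> E Y e" using FO by (simp add: monomorphism_def)
  then show ?thesis using that conf eq by blast
qed

text \<open>As \<open>e\<close> is monic in the heart, \<open>e \<cdot> q\<close> and
  \<open>q\<close> kill the same morphisms from the heart, so they share the kernel
  \<open>k\<close>.\<close>

lemma kernel_of_coimage_factorization:
  assumes c: "(K, X, E, k, q) \<in> conflations_within D H" and e: "monomorphism \<H> E Y e" and Y: "Y \<in> H"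
  shows "is_kernel \<H> X Y (e \<cdot> q) K k"
proof -
  have c': "(K, X, E, k, q) \<in> conflations D" and E: "E \<in> H" using c by (simp_all add: conflations_within_def)
  note cc = conflationD[OF c']
  have YO: "Y \<in> Obj D" using Y T2_Obj by blast
  have eY: "e \<in> mor D E Y" using e by (simp add: monomorphism_def)
  have "(e \<cdot> q) \<cdot> g = zero_mor D W Y \<longleftrightarrow> q \<cdot> g = zero_mor D W E" if W: "W \<in> H" and g: "g \<in> mor D W X" for W g
  proof -
    have WO: "W \<in> Obj D" using W T2_Obj by blast
    have "(e \<cdot> q) \<cdot> g = e \<cdot> (q \<cdot> g)" using comp_assoc[OF WO cc(2,3) YO g cc(5) eY] .
    moreover have "e \<cdot> zero_mor D W E = zero_mor D W Y" using comp_zero_right[OF WO cc(3) YO eY] .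
    moreover have "q \<cdot> g \<in> mor D W E" "zero_mor D W E \<in> mor D W E"
      using comp_in[OF WO cc(2,3) g cc(5)] zero_in[OF WO cc(3)] by blast+
    ultimately show ?thesis using e W unfolding monomorphism_def by (metis full_subcategory_simps(1,2,4))
  qed
  then show ?thesis
    using kernel_within[OF c] unfolding is_kernel_def by simp
qed

text \<open>The semi-abelian axiom concerns every choice of kernel and coimage, so the constructed
  factorization is transferred to the given choice.\<close>

lemma heart_coimage_mono:
  assumes X: "X \<in> H" and Y: "Y \<in> H" and f: "f \<in> mor D X Y"
    and K: "is_kernel \<H> X Y f K k" "is_cokernel \<H> K X k Q q"
  shows "\<exists>v. monomorphism \<H> Q Y v \<and> v \<cdot> q = f"
proof -
  interpret \<H>: additive_category \<H> by (rule heart_additive)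
  obtain L l E h e where c: "(L, X, E, l, h) \<in> conflations_within D H" "monomorphism \<H> E Y e" "e \<cdot> h = f"
    by (rule coimage_factorization[OF X Y f])
  show ?thesis
    using \<H>.coimage_mono[of X Y f K k Q q L l E h e] kernel_of_coimage_factorization[OF c(1,2) Y]
      cokernel_within[OF c(1)] X Y f K c by simp
qed

text \<open>The image of \<open>f\<close> is the coimage of \<open>f\<close> in the opposite
  category.\<close>

lemma heart_image_epi:
  assumes "X \<in> H" "Y \<in> H" "f \<in> mor D X Y" "is_cokernel \<H> X Y f Z c" "is_kernel \<H> Y Z c I m"
  shows "\<exists>p. epimorphism \<H> X I p \<and> m \<cdot> p = f"
  using abelian_like_heart.heart_coimage_mono[OF heart_dual, of Y X f Z c I m] assms
  by (simp add: Int_commute)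

lemma heart_has_kernel:
  assumes X: "X \<in> H" and Y: "Y \<in> H" and f: "f \<in> mor D X Y"
  shows "\<exists>K k. is_kernel \<H> X Y f K k"
proof -
  obtain K k E q e where "(K, X, E, k, q) \<in> conflations_within D H" "monomorphism \<H> E Y e" "e \<cdot> q = f"
    by (rule coimage_factorization[OF X Y f])
  then show ?thesis using kernel_of_coimage_factorization Y by blast
qed

lemma heart_has_cokernel:
  assumes "X \<in> H" "Y \<in> H" "f \<in> mor D X Y"
  shows "\<exists>Z c. is_cokernel \<H> X Y f Z c"
  using abelian_like_heart.heart_has_kernel[OF heart_dual, of Y X f] assms by (simp add: Int_commute)

lemma heart_semi_abelian: "semi_abelian_category \<H>"
proof (intro semi_abelian_category.intro heart_additive semi_abelian_category_axioms.intro)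
  interpret \<H>: additive_category \<H> by (rule heart_additive)
  fix X Y f assume "X \<in> Obj \<H>" "Y \<in> Obj \<H>" and f: "f \<in> mor \<H> X Y"
  then have X: "X \<in> H" and Y: "Y \<in> H" and f': "f \<in> mor D X Y" by simp_all
  show "\<exists>K k. is_kernel \<H> X Y f K k" "\<exists>Z c. is_cokernel \<H> X Y f Z c"
    using heart_has_kernel heart_has_cokernel X Y f' by blast+
  fix K k Q q Z c I m
  assume K: "is_kernel \<H> X Y f K k" and Q: "is_cokernel \<H> K X k Q q"
    and Z: "is_cokernel \<H> X Y f Z c" and I: "is_kernel \<H> Y Z c I m"
  have KH: "K \<in> H" "k \<in> mor D K X" and QH: "Q \<in> H" "q \<in> mor D X Q"
    and ZH: "Z \<in> H" "c \<in> mor D Y Z" "c \<cdot> f = zero_mor D X Z" and IH: "I \<in> H" "m \<in> mor D I Y"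
    using K Q Z I by (simp_all add: is_kernel_def is_cokernel_def)
  have O: "X \<in> Obj D" "Y \<in> Obj D" "K \<in> Obj D" "Q \<in> Obj D" "Z \<in> Obj D" "I \<in> Obj D"
    using X Y KH QH ZH IH T2_Obj by blast+
  obtain v where v: "monomorphism \<H> Q Y v" "v \<cdot> q = f"
    using heart_coimage_mono[OF X Y f' K Q] by blast
  obtain p where p: "epimorphism \<H> X I p" "m \<cdot> p = f"
    using heart_image_epi[OF X Y f' Z I] by blast
  have vY: "v \<in> mor D Q Y" and pI: "p \<in> mor D X I"
    using v p by (simp_all add: monomorphism_def epimorphism_def)
  \<comment> \<open>Both sides are zero, the left one being \<open>c \<cdot> f\<close>. Cancelling
    \<open>q\<close> shows that \<open>v\<close> factors through the kernel \<open>m\<close> of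
    \<open>c\<close>, and this factor \<open>u\<close> is the canonical morphism.\<close>
  have "(c \<cdot> v) \<cdot> q = zero_mor D Q Z \<cdot> q"
    using comp_assoc[of X Q Y Z q v c] comp_zero_left[of X Q Z q] O QH vY ZH v by simp
  then have "c \<cdot> v = zero_mor D Q Z"
    using \<H>.cokernel_right_cancel[of K X Z k Q q "c \<cdot> v" "zero_mor D Q Z"] KH QH ZH X Q
      comp_in[OF O(4,2,5) vY ZH(2)] zero_in[OF O(4,5)] by simp
  then obtain u where u: "u \<in> mor D Q I" "m \<cdot> u = v"
    using I QH(1) vY unfolding is_kernel_def by (metis full_subcategory_simps(1,2,4))
  have uq: "u \<cdot> q \<in> mor D X I" using comp_in[OF O(1,4,6) QH(2) u(1)] .
  have muq: "m \<cdot> (u \<cdot> q) = f" using comp_assoc[OF O(1,4,6,2) QH(2) u(1) IH(2)] u v by simp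
  \<comment> \<open>Both \<open>u \<cdot> q\<close> and \<open>p\<close> become \<open>f\<close>
    after composing with the kernel \<open>m\<close>. Now \<open>u\<close> is monic since
    \<open>m \<cdot> u = v\<close> is, and epic since \<open>u \<cdot> q = p\<close> is.\<close>
  then have uqp: "u \<cdot> q = p"
    using \<H>.kernel_left_cancel[of Y Z X c I m "u \<cdot> q" p] p pI uq X Y ZH I by simp
  have mono: "monomorphism \<H> Q I u"
    unfolding monomorphism_def
  proof (intro conjI ballI impI)
    show "u \<in> mor \<H> Q I" using u by simp
    fix W g h assume W: "W \<in> Obj \<H>" and g: "g \<in> mor \<H> W Q" "h \<in> mor \<H> W Q" "u \<cdot>\<^bsub>\<H>\<^esub> g = u \<cdot>\<^bsub>\<H>\<^esub> h"
    then have WO: "W \<in> Obj D" using T2_Obj by simp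
    have "v \<cdot> g = v \<cdot> h"
      using comp_assoc[of W Q I Y g u m] comp_assoc[of W Q I Y h u m] WO O g u IH by simp
    then show "g = h" using v(1) W g unfolding monomorphism_def by simp
  qed
  have epi: "epimorphism \<H> Q I u"
    unfolding epimorphism_def
  proof (intro conjI ballI impI)
    show "u \<in> mor \<H> Q I" using u by simp
    fix W g h assume W: "W \<in> Obj \<H>" and g: "g \<in> mor \<H> I W" "h \<in> mor \<H> I W" "g \<cdot>\<^bsub>\<H>\<^esub> u = h \<cdot>\<^bsub>\<H>\<^esub> u"
    then have WO: "W \<in> Obj D" using T2_Obj by simp
    have "g \<cdot> p = h \<cdot> p"
      using comp_assoc[of X Q I W q u g] comp_assoc[of X Q I W q u h] WO O g u QH uqp by simp
    then show "g = h" using p(1) W g unfolding epimorphism_def by simp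
  qed
  show "\<exists>u\<in>mor \<H> Q I. m \<cdot>\<^bsub>\<H>\<^esub> u \<cdot>\<^bsub>\<H>\<^esub> q = f \<and> monomorphism \<H> Q I u \<and> epimorphism \<H> Q I u"
    using u(1) muq mono epi by auto
qed

end

theorem theorem3p13:
  fixes D :: "('o, 'm, 'e, 'n) neg_extri" and t1 t2 :: "'o set \<times> 'o set"
  assumes "neg_extriangulated_category D"
    and "normal_interval D t1 t2"
    and "\<And>X Y f. \<lbrakk>X \<in> heart t1 t2; Y \<in> heart t1 t2; f \<in> carrier (Hom D X Y)\<rbrakk> \<Longrightarrow>
      (\<exists>Z c. (X, Y, Z, f, c) \<in> conflations D) \<and> (\<exists>K k. (K, X, Y, k, f) \<in> conflations D)"
  shows "exact_category (full_subcategory D (heart t1 t2)) (conflations_within D (heart t1 t2)) \<and>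
    semi_abelian_category (full_subcategory D (heart t1 t2))"
proof -
  have "abelian_like_heart D (fst t1) (snd t1) (fst t2) (snd t2)"
    using assms by (simp add: abelian_like_heart_def abelian_like_heart_axioms_def heart_def)
  then show ?thesis
    using abelian_like_heart.heart_exact abelian_like_heart.heart_semi_abelian
    unfolding heart_def by blast
qed

end
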